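(* Let $\mathcal L=\langle x_1,\dots,x_n\rangle_{\mathrm{Lie}}$ be a Lie algebra over $\mathbb F$ whose generators $x_1,\dots,x_n$ realize the graph $\Gamma_{A;n}$. Suppose that the following Zariski-open conditions on the extremal form $f$ hold: $$f(x_1,[x_2,x_3])^2\ne 2f(x_1,x_2)f(x_1,x_3)f(x_2,x_3)\quad\text{and}\quad f(x_i,x_{i+1})\ne0\ \text{ for all } i .$$ Then: (i) if $\operatorname{char}\mathbb F=p>0$ and $p\mid n$, then $\mathcal L$ is isomorphic to either $\mathfrak{sl}_n$ or its simple subalgebra of codimension $1$; (ii) otherwise, $\mathcal L$ is isomorphic to $\mathfrak{sl}_n$.
   Context: $\mathbb F$ is an algebraically closed field of characteristic not $2$. $\Gamma_{A;n}$ ($n\ge3$) is the graph on $\{1,\dots,n\}$ with edges $\{i,i+1\}$ for $1\le i\le n-1$ together with $\{1,3\}$; the condition "for all $i$" means for $1\le i\le n-1$. A nonzero element $x$ of a Lie algebra $\mathcal L$ is extremal if $[x,[x,\mathcal L]]\subseteq\mathbb Fx$. If $\mathcal L$ is generated by extremal elements, the extremal form is the unique bilinear form $f$ on $\mathcal L$ with $[x,[x,y]]=f(x,y)x$ for all extremal $x$ and all $y\in\mathcal L$. Elements $x_1,\dots,x_n$ of a Lie algebra realize a graph on $\{1,\dots,n\}$ if each $x_i$ is an extremal element of the Lie algebra they generate and, for $i\ne j$, the vertices $i,j$ are adjacent if and only if $[x_i,x_j]\ne0$. $\mathfrak{sl}_n$ is the Lie algebra of trace-zero $n\times n$ matrices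 over $\mathbb F$.
   Formalization: In (i), "its simple subalgebra of codimension 1" is replaced by the simple quotient of sl_n by a one-dimensional ideal; when p divides n no simple subalgebra of codimension 1 exists, and the quotient by the scalars does occur. *)

theory Defs
  imports "HOL-Analysis.Analysis" "HOL-Computational_Algebra.Computational_Algebra"
begin

locale lie_algebra = vector_space smul
  for smul :: "'k::field \<Rightarrow> 'v::ab_group_add \<Rightarrow> 'v" +
  fixes bracket :: "'v \<Rightarrow> 'v \<Rightarrow> 'v"
  assumes bracket_add_left: "bracket (x + y) z = bracket x z + bracket y z"
    and bracket_add_right: "bracket x (y + z) = bracket x y + bracket x z"
    and bracket_scale_left: "bracket (smul c x) y = smul c (bracket x y)"
    and bracket_scale_right: "bracket x (smul c y) = smul c (bracket x y)"
    and bracket_self: "bracket x x = 0"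
    and jacobi: "bracket x (bracket y z) + bracket y (bracket z x) + bracket z (bracket x y) = 0"

definition lie_subalgebra ::
  "('k::field \<Rightarrow> 'v::ab_group_add \<Rightarrow> 'v) \<Rightarrow> ('v \<Rightarrow> 'v \<Rightarrow> 'v) \<Rightarrow> 'v set \<Rightarrow> bool" where
  "lie_subalgebra smul bracket S \<longleftrightarrow>
     module.subspace smul S \<and> (\<forall>a\<in>S. \<forall>b\<in>S. bracket a b \<in> S)"

definition lie_generated ::
  "('k::field \<Rightarrow> 'v::ab_group_add \<Rightarrow> 'v) \<Rightarrow> ('v \<Rightarrow> 'v \<Rightarrow> 'v) \<Rightarrow> 'v set \<Rightarrow> 'v set" where
  "lie_generated smul bracket X = lie_subalgebra smul bracket hull X"

text \<open>Subalgebras and quotients have to be treated as Lie algebras in their own right and compared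
  up to isomorphism. The elements of a quotient are cosets, whose type carries no suitable group
  structure, so a Lie algebra considered as an object is a carrier together with its operations.\<close>

record ('k, 'v) lie_alg =
  lcarrier :: "'v set"
  lzero :: 'v
  ladd :: "'v \<Rightarrow> 'v \<Rightarrow> 'v"
  lscale :: "'k \<Rightarrow> 'v \<Rightarrow> 'v"
  lbracket :: "'v \<Rightarrow> 'v \<Rightarrow> 'v"

definition lie_alg_on ::
  "('k::field \<Rightarrow> 'v::ab_group_add \<Rightarrow> 'v) \<Rightarrow> ('v \<Rightarrow> 'v \<Rightarrow> 'v) \<Rightarrow> 'v set \<Rightarrow> ('k, 'v) lie_alg" where
  "lie_alg_on smul bracket S =
     \<lparr>lcarrier = S, lzero = 0, ladd = (+), lscale = smul, lbracket = bracket\<rparr>"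

definition lie_isomorphic :: "('k, 'v) lie_alg \<Rightarrow> ('k, 'w) lie_alg \<Rightarrow> bool" where
  "lie_isomorphic G H \<longleftrightarrow> (\<exists>\<phi>. bij_betw \<phi> (lcarrier G) (lcarrier H) \<and>
     (\<forall>a\<in>lcarrier G. \<forall>b\<in>lcarrier G. \<phi> (ladd G a b) = ladd H (\<phi> a) (\<phi> b)) \<and>
     (\<forall>c. \<forall>a\<in>lcarrier G. \<phi> (lscale G c a) = lscale H c (\<phi> a)) \<and>
     (\<forall>a\<in>lcarrier G. \<forall>b\<in>lcarrier G. \<phi> (lbracket G a b) = lbracket H (\<phi> a) (\<phi> b)))"

definition lie_ideal :: "('k, 'v) lie_alg \<Rightarrow> 'v set \<Rightarrow> bool" where
  "lie_ideal G I \<longleftrightarrow> I \<subseteq> lcarrier G \<and> lzero G \<in> I \<and>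
     (\<forall>a\<in>I. \<forall>b\<in>I. ladd G a b \<in> I) \<and> (\<forall>c. \<forall>a\<in>I. lscale G c a \<in> I) \<and>
     (\<forall>a\<in>lcarrier G. \<forall>b\<in>I. lbracket G a b \<in> I)"

definition lie_simple :: "('k, 'v) lie_alg \<Rightarrow> bool" where
  "lie_simple G \<longleftrightarrow>
     (\<exists>a\<in>lcarrier G. \<exists>b\<in>lcarrier G. lbracket G a b \<noteq> lzero G) \<and>
     (\<forall>I. lie_ideal G I \<longrightarrow> I = {lzero G} \<or> I = lcarrier G)"

definition lie_coset :: "('k, 'v) lie_alg \<Rightarrow> 'v set \<Rightarrow> 'v \<Rightarrow> 'v set" where
  "lie_coset G I a = ladd G a ` I"

text \<open>For an ideal \<open>I\<close> each of the unions below is a union of equal cosets.\<close>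

definition lie_quotient :: "('k, 'v) lie_alg \<Rightarrow> 'v set \<Rightarrow> ('k, 'v set) lie_alg" where
  "lie_quotient G I =
     \<lparr>lcarrier = lie_coset G I ` lcarrier G,
      lzero = lie_coset G I (lzero G),
      ladd = (\<lambda>A B. \<Union>a\<in>A. \<Union>b\<in>B. lie_coset G I (ladd G a b)),
      lscale = (\<lambda>c A. \<Union>a\<in>A. lie_coset G I (lscale G c a)),
      lbracket = (\<lambda>A B. \<Union>a\<in>A. \<Union>b\<in>B. lie_coset G I (lbracket G a b))\<rparr>"

definition extremal :: "('k, 'v) lie_alg \<Rightarrow> 'v \<Rightarrow> bool" where
  "extremal G x \<longleftrightarrow> x \<in> lcarrier G \<and> x \<noteq> lzero G \<and>
     (\<forall>y\<in>lcarrier G. \<exists>c. lbracket G x (lbracket G x y) = lscale G c x)"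

definition bilinear_form_on :: "('k::field, 'v) lie_alg \<Rightarrow> ('v \<Rightarrow> 'v \<Rightarrow> 'k) \<Rightarrow> bool" where
  "bilinear_form_on G f \<longleftrightarrow>
     (\<forall>a\<in>lcarrier G. \<forall>b\<in>lcarrier G. \<forall>z\<in>lcarrier G.
        f (ladd G a b) z = f a z + f b z \<and> f z (ladd G a b) = f z a + f z b) \<and>
     (\<forall>c. \<forall>a\<in>lcarrier G. \<forall>z\<in>lcarrier G.
        f (lscale G c a) z = c * f a z \<and> f z (lscale G c a) = c * f z a)"

text \<open>If \<open>G\<close> is generated by extremal elements, this determines \<open>f\<close> on the carrier of \<open>G\<close>
  (which is then spanned by extremal elements); values of \<open>f\<close> elsewhere are irrelevant.\<close>

definition extremal_form :: "('k::field, 'v) lie_alg \<Rightarrow> ('v \<Rightarrow> 'v \<Rightarrow> 'k) \<Rightarrow> bool" where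
  "extremal_form G f \<longleftrightarrow> bilinear_form_on G f \<and>
     (\<forall>x y. extremal G x \<and> y \<in> lcarrier G \<longrightarrow>
        lbracket G x (lbracket G x y) = lscale G (f x y) x)"

text \<open>A graph on \<open>{1..n}\<close> is given by its set of edges, each edge being a two-element set.\<close>

definition Gamma_A :: "nat \<Rightarrow> nat set set" where
  "Gamma_A n = {{i, i + 1} | i. 1 \<le> i \<and> i \<le> n - 1} \<union> {{1, 3}}"

definition realizes_graph ::
  "('k::field \<Rightarrow> 'v::ab_group_add \<Rightarrow> 'v) \<Rightarrow> ('v \<Rightarrow> 'v \<Rightarrow> 'v) \<Rightarrow> nat \<Rightarrow> nat set set \<Rightarrow>
     (nat \<Rightarrow> 'v) \<Rightarrow> bool" where
  "realizes_graph smul bracket n E x \<longleftrightarrow>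
     (\<forall>i\<in>{1..n}. extremal (lie_alg_on smul bracket (lie_generated smul bracket (x ` {1..n}))) (x i)) \<and>
     (\<forall>i\<in>{1..n}. \<forall>j\<in>{1..n}. i \<noteq> j \<longrightarrow> ({i, j} \<in> E \<longleftrightarrow> bracket (x i) (x j) \<noteq> 0))"

definition mat_scale :: "'k::field \<Rightarrow> 'k^'n^'n \<Rightarrow> 'k^'n^'n" where
  "mat_scale c A = (\<chi> i j. c * A $ i $ j)"

definition mat_bracket :: "'k::field^'n^'n \<Rightarrow> 'k^'n^'n \<Rightarrow> 'k^'n^'n" where
  "mat_bracket A B = A ** B - B ** A"

lemma matrix_add_rdistrib': "((A :: 'k::field^'n^'n) + B) ** C = A ** C + B ** C"
  by (vector matrix_matrix_mult_def sum.distrib[symmetric] distrib_right)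

lemma matrix_sub_ldistrib': "(A :: 'k::field^'n^'n) ** (B - C) = A ** B - A ** C"
  by (vector matrix_matrix_mult_def sum_subtractf[symmetric] right_diff_distrib)

lemma matrix_sub_rdistrib': "((A :: 'k::field^'n^'n) - B) ** C = A ** C - B ** C"
  by (vector matrix_matrix_mult_def sum_subtractf[symmetric] left_diff_distrib)

lemma mat_scale_mult_left: "mat_scale c A ** B = mat_scale c (A ** B)"
  by (simp add: mat_scale_def matrix_matrix_mult_def vec_eq_iff sum_distrib_left mult.assoc)

lemma mat_scale_mult_right: "A ** mat_scale c B = mat_scale c (A ** B)"
  by (simp add: mat_scale_def matrix_matrix_mult_def vec_eq_iff sum_distrib_left algebra_simps)

lemma mat_scale_diff: "mat_scale c (A - B) = mat_scale c A - mat_scale c B"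
  by (simp add: mat_scale_def vec_eq_iff algebra_simps)

lemma lie_algebra_gl: "lie_algebra mat_scale (mat_bracket :: 'k::field^'n^'n \<Rightarrow> _)"
proof
  fix a b :: 'k and x y z :: "'k^'n^'n"
  show "mat_scale a (x + y) = mat_scale a x + mat_scale a y"
    "mat_scale (a + b) x = mat_scale a x + mat_scale b x"
    "mat_scale a (mat_scale b x) = mat_scale (a * b) x" "mat_scale 1 x = x"
    by (simp_all add: mat_scale_def vec_eq_iff algebra_simps)
  show "mat_bracket (x + y) z = mat_bracket x z + mat_bracket y z"
    "mat_bracket x (y + z) = mat_bracket x y + mat_bracket x z"
    "mat_bracket x x = 0"
    by (simp_all add: mat_bracket_def matrix_add_ldistrib matrix_add_rdistrib')
  show "mat_bracket (mat_scale a x) y = mat_scale a (mat_bracket x y)"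
    "mat_bracket x (mat_scale a y) = mat_scale a (mat_bracket x y)"
    by (simp_all add: mat_bracket_def mat_scale_mult_left mat_scale_mult_right mat_scale_diff)
  show "mat_bracket x (mat_bracket y z) + mat_bracket y (mat_bracket z x) +
      mat_bracket z (mat_bracket x y) = 0"
    by (simp add: mat_bracket_def matrix_sub_ldistrib' matrix_sub_rdistrib' matrix_mul_assoc)
qed

text \<open>If the characteristic is \<open>p > 2\<close> and \<open>p\<close> divides \<open>n \<ge> 3\<close>, the scalar matrices form a one-dimensional
  ideal of \<open>sl\<close> with simple quotient. This quotient is the simple Lie algebra of codimension 1 attached
  to \<open>sl\<close>; it does not embed as a subalgebra, since \<open>sl\<close> is perfect.\<close>

definition sl :: "('k::field, 'k^'n^'n) lie_alg" where
  "sl = lie_alg_on mat_scale mat_bracket {A. trace A = 0}"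

lemma lie_subalgebra_sl:
  "lie_subalgebra mat_scale mat_bracket {A :: 'k::field^'n^'n. trace A = 0}"
proof -
  interpret gl: lie_algebra mat_scale "mat_bracket :: 'k^'n^'n \<Rightarrow> _"
    by (rule lie_algebra_gl)
  have "trace (A ** B) = trace (B ** A)" for A B :: "'k^'n^'n"
    by (rule trace_mul_sym)
  moreover have "trace (mat_scale c A) = c * trace A" for c and A :: "'k^'n^'n"
    by (simp add: trace_def mat_scale_def sum_distrib_left)
  ultimately show ?thesis
    by (auto simp: lie_subalgebra_def gl.subspace_def mat_bracket_def trace_add trace_sub trace_0[simplified]
        trace_def mat_scale_def sum_distrib_left[symmetric] sum.distrib sum_subtractf)
qed

end

theory Submission
  imports Defs
begin

text \<open>For every \<open>m\<close> with \<open>3 \<le> m \<le> n\<close>, the subalgebra generated by \<open>x\<^sub>1, \<dots>, x\<^sub>m\<close> is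
  a homomorphic image of \<open>sl\<^sub>m\<close>: it contains extremal elements \<open>e\<^sub>i\<^sub>j\<close> satisfying the relations of
  the off-diagonal matrix units, and those with \<open>i, j < m\<close> generate the subalgebra of
  \<open>x\<^sub>1, \<dots>, x\<^bsub>m-1\<^esub>\<close>. As \<open>x\<^bsub>m+1\<^esub>\<close> commutes with that smaller subalgebra and
  \<open>f (x\<^sub>m, x\<^bsub>m+1\<^esub>) \<noteq> 0\<close>, the functional \<open>f (x\<^bsub>m+1\<^esub>, -)\<close> vanishes on every
  \<open>e\<^sub>i\<^sub>m\<close> and \<open>e\<^sub>m\<^sub>i\<close> but not on the torus, and from this alone the extremal identities
  determine the action on \<open>x\<^bsub>m+1\<^esub>\<close> and yield the matrix units with the new index.

  The same extension step starts the induction at \<open>sl\<^sub>2\<close>, generated by \<open>x\<^sub>1\<close> and \<open>x\<^sub>2\<close>. Nothing is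
  required to commute with \<open>x\<^sub>3\<close> there, and the discriminant condition is what makes it possible to
  choose root vectors on which \<open>f (x\<^sub>3, -)\<close> vanishes. Finally, the kernel of a nonzero homomorphism
  from \<open>sl\<^sub>n\<close> consists of scalar matrices.\<close>

section \<open>The extremal form\<close>

text \<open>The constants come from one model. A square-zero matrix x of rank one satisfies x y x =
  tr(x y) x, hence [x,[x,y]] = -2 tr(x y) x, so on such elements of \<open>sl\<close> the extremal
  form is -2 times the trace form. This is why opposite matrix units are scaled to have
  \<open>f\<close>-value -2. A generator that sees only the last index u is modelled by the rank-one
  matrix with column e_u + e_m and row e_u - e_m, where m is the new index; its
  \<open>f\<close>-value on E_ii - E_uu is 2. The formulas for the new root vectors are read off
  from this matrix.

  The obstacle is that neither the dimension nor a basis of the algebra is known in advance, so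
  linear independence can never be invoked. Every step checks relations between concrete elements,
  by evaluating nested brackets, and relations yield only a surjection from \<open>sl\<close>;
  injectivity is left to the ideal structure of \<open>sl\<close>.

  Many identities first appear as equations between doubled vectors. As 2 is the only integer ever
  cancelled, characteristic 3 gets no separate treatment.\<close>

context lie_algebra
begin

notation bracket (infixr "\<star>" 70)
notation smul (infixr "\<odot>" 75)


lemma bracket_zero [simp]: "0 \<star> x = 0" "x \<star> 0 = 0"
  using bracket_add_left[of 0 0 x] bracket_add_right[of x 0 0] by simp_all

lemma bracket_minus [simp]: "(- x) \<star> y = - (x \<star> y)" "x \<star> (- y) = - (x \<star> y)"
  using bracket_add_left[of x "- x" y] bracket_add_right[of x y "- y"]
  by (simp_all add: eq_neg_iff_add_eq_0 add.commute)

lemma bracket_diff: "(x - y) \<star> z = x \<star> z - y \<star> z" "x \<star> (y - z) = x \<star> y - x \<star> z"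
  using bracket_add_left[of x "- y" z] bracket_add_right[of x y "- z"] by simp_all

lemma bracket_skew: "x \<star> y = - (y \<star> x)"
proof -
  have "(x + y) \<star> (x + y) = x \<star> y + y \<star> x"
    by (simp only: bracket_add_left bracket_add_right) (simp add: bracket_self)
  hence "x \<star> y + y \<star> x = 0" by (simp add: bracket_self)
  thus ?thesis by (simp only: eq_neg_iff_add_eq_0)
qed

lemma bracket_leibniz: "a \<star> b \<star> y = (a \<star> b) \<star> y + b \<star> a \<star> y"
proof -
  have "a \<star> b \<star> y + b \<star> y \<star> a + y \<star> a \<star> b = 0" by (rule jacobi)
  moreover have "b \<star> y \<star> a = - (b \<star> a \<star> y)" by (subst bracket_skew[of y a]) simp
  moreover have "y \<star> a \<star> b = - ((a \<star> b) \<star> y)" by (rule bracket_skew)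
  ultimately show ?thesis by (simp add: algebra_simps)
qed

lemma bracket_bracket: "(a \<star> b) \<star> y = a \<star> b \<star> y - b \<star> a \<star> y"
  using bracket_leibniz[of a b y] by simp

lemmas bracket_linear =
  bracket_add_left bracket_add_right bracket_scale_left bracket_scale_right bracket_diff bracket_self

lemma scale_two: "(c * 2) \<odot> v = c \<odot> v + c \<odot> v" "(2 * c) \<odot> v = c \<odot> v + c \<odot> v" "2 \<odot> v = v + v"
  by (metis mult_2_right scale_left_distrib, metis mult_2 scale_left_distrib,
      metis one_add_one scale_left_distrib scale_one)

lemmas scale_linear = scale_left_distrib scale_right_distrib scale_right_diff_distrib
  scale_left_diff_distrib scale_two

lemma lie_generated_subalgebra: "lie_subalgebra smul bracket (lie_generated smul bracket X)"
  unfolding lie_generated_def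
  by (rule hull_in) (auto simp: lie_subalgebra_def intro!: subspace_Inter)

lemma lie_generated_superset: "X \<subseteq> lie_generated smul bracket X"
  unfolding lie_generated_def by (rule hull_subset)

lemma lie_generated_least:
  "lie_subalgebra smul bracket S \<Longrightarrow> X \<subseteq> S \<Longrightarrow> lie_generated smul bracket X \<subseteq> S"
  unfolding lie_generated_def by (rule hull_minimal)

lemma lie_generated_eqI:
  assumes "X \<subseteq> lie_generated smul bracket Y" "Y \<subseteq> lie_generated smul bracket X"
  shows "lie_generated smul bracket X = lie_generated smul bracket Y"
  by (meson assms lie_generated_least lie_generated_subalgebra subset_antisym)

lemma lie_subalgebraD:
  assumes "lie_subalgebra smul bracket S"
  shows "0 \<in> S" "a \<in> S \<Longrightarrow> b \<in> S \<Longrightarrow> a + b \<in> S" "a \<in> S \<Longrightarrow> c \<odot> a \<in> S"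
    "a \<in> S \<Longrightarrow> b \<in> S \<Longrightarrow> a \<star> b \<in> S" "a \<in> S \<Longrightarrow> - a \<in> S"
    "a \<in> S \<Longrightarrow> b \<in> S \<Longrightarrow> a - b \<in> S" "(\<And>i. i \<in> I \<Longrightarrow> g i \<in> S) \<Longrightarrow> sum g I \<in> S"
  using assms
  by (auto simp: lie_subalgebra_def subspace_0 subspace_add subspace_scale subspace_neg subspace_diff
      subspace_sum)

lemma lie_subalgebra_centralizer: "lie_subalgebra smul bracket {c. c \<star> x = 0}"
  by (auto simp: lie_subalgebra_def subspace_def bracket_add_left bracket_scale_left bracket_bracket)

end

text \<open>The algebra is a subset \<open>L\<close> of the ambient type, because the subalgebra
  generated by the given elements need not be everything; facts about \<open>f\<close> therefore
  carry membership in \<open>L\<close>. The last assumption is the source of symmetry and invariance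
  of \<open>f\<close>: both are proved on extremal elements and spread by linearity.\<close>

locale extremal_algebra = lie_algebra smul bracket
  for smul :: "'k::field \<Rightarrow> 'v::ab_group_add \<Rightarrow> 'v" (infixr "\<odot>" 75)
    and bracket :: "'v \<Rightarrow> 'v \<Rightarrow> 'v" (infixr "\<star>" 70) +
  fixes L :: "'v set" and f :: "'v \<Rightarrow> 'v \<Rightarrow> 'k"
  assumes two [simp]: "(2 :: 'k) \<noteq> 0"
    and L_sub: "lie_subalgebra smul bracket L"
    and f_add_left: "a \<in> L \<Longrightarrow> b \<in> L \<Longrightarrow> z \<in> L \<Longrightarrow> f (a + b) z = f a z + f b z"
    and f_add_right: "a \<in> L \<Longrightarrow> b \<in> L \<Longrightarrow> z \<in> L \<Longrightarrow> f z (a + b) = f z a + f z b"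
    and f_scale_left: "a \<in> L \<Longrightarrow> z \<in> L \<Longrightarrow> f (c \<odot> a) z = c * f a z"
    and f_scale_right: "a \<in> L \<Longrightarrow> z \<in> L \<Longrightarrow> f z (c \<odot> a) = c * f z a"
    and f_extremal: "x \<in> L \<Longrightarrow> x \<noteq> 0 \<Longrightarrow> \<forall>y\<in>L. \<exists>c. x \<star> x \<star> y = c \<odot> x \<Longrightarrow> y \<in> L \<Longrightarrow>
      x \<star> x \<star> y = f x y \<odot> x"
    and L_generated: "L \<subseteq> lie_generated smul bracket {x \<in> L. \<forall>y\<in>L. \<exists>c. x \<star> x \<star> y = c \<odot> x}"
begin

lemmas L_closed [simp, intro] = lie_subalgebraD[OF L_sub]

definition ext :: "'v \<Rightarrow> bool" where
  "ext x \<longleftrightarrow> x \<in> L \<and> (\<forall>y\<in>L. \<exists>c. x \<star> x \<star> y = c \<odot> x)"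

lemma ext_in [simp, intro]: "ext x \<Longrightarrow> x \<in> L"
  by (simp add: ext_def)

lemma f_zero [simp]: "z \<in> L \<Longrightarrow> f 0 z = 0" "z \<in> L \<Longrightarrow> f z 0 = 0"
  using f_scale_left[of 0 z 0] f_scale_right[of 0 z 0] by simp_all

lemma f_minus [simp]:
  "a \<in> L \<Longrightarrow> z \<in> L \<Longrightarrow> f (- a) z = - f a z" "a \<in> L \<Longrightarrow> z \<in> L \<Longrightarrow> f z (- a) = - f z a"
  using f_scale_left[of a z "-1"] f_scale_right[of a z "-1"] by simp_all

lemma f_diff: "a \<in> L \<Longrightarrow> b \<in> L \<Longrightarrow> z \<in> L \<Longrightarrow> f (a - b) z = f a z - f b z"
    "a \<in> L \<Longrightarrow> b \<in> L \<Longrightarrow> z \<in> L \<Longrightarrow> f z (a - b) = f z a - f z b"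
  using f_add_left[of a "- b" z] f_add_right[of a "- b" z] by simp_all

lemmas f_linear = f_add_left f_add_right f_scale_left f_scale_right f_diff

lemma ext_square: "ext x \<Longrightarrow> y \<in> L \<Longrightarrow> x \<star> x \<star> y = f x y \<odot> x"
  unfolding ext_def by (cases "x = 0") (simp, blast intro: f_extremal)

lemma extI: "x \<in> L \<Longrightarrow> (\<And>y. y \<in> L \<Longrightarrow> x \<star> x \<star> y = c y \<odot> x) \<Longrightarrow> ext x"
  unfolding ext_def by blast

lemma f_eqI: "ext x \<Longrightarrow> x \<noteq> 0 \<Longrightarrow> y \<in> L \<Longrightarrow> x \<star> x \<star> y = c \<odot> x \<Longrightarrow> f x y = c"
  using ext_square[of x y] by simp

lemma ext_scale: assumes "ext x" shows "ext (c \<odot> x)"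
  by (rule extI[where c = "\<lambda>y. c * f x y"])
     (use assms in \<open>auto simp: bracket_linear scale_linear ext_square mult_ac\<close>)

lemma ext_minus: "ext x \<Longrightarrow> ext (- x)"
  using ext_scale[of x "-1"] by simp

section \<open>Premet identities and exponentials of extremal elements\<close>

lemma half: obtains p where "(c :: 'k) = p + p"
  by (rule that[of "c / 2"]) (use two in \<open>simp add: field_simps\<close>)

lemma double_cancel: "v + v = w + w \<Longrightarrow> v = (w :: 'v)"
proof -
  assume "v + v = w + w"
  hence "(2 :: 'k) \<odot> v = 2 \<odot> w"
    by (simp add: scale_two)
  thus ?thesis using two by simp
qed

text \<open>Premet's identities. Expanding \<open>b \<star> b \<star> c \<star> y\<close> by the
  Leibniz rule produces the mixed product twice, and every other term contains the square of ad b,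
  which extremality turns into a value of \<open>f\<close>. The second identity trades the factor
  \<open>b \<star> c\<close> for nested brackets, the form needed for alternating words.\<close>

lemma premet:
  assumes b: "ext b" and c: "c \<in> L" and y: "y \<in> L"
  shows "(b \<star> c) \<star> b \<star> y + (b \<star> c) \<star> b \<star> y = f b (c \<star> y) \<odot> b - f b c \<odot> (b \<star> y) + f b y \<odot> (b \<star> c)"
    and "b \<star> c \<star> b \<star> y + b \<star> c \<star> b \<star> y = f b (c \<star> y) \<odot> b - f b c \<odot> (b \<star> y) - f b y \<odot> (b \<star> c)"
proof -
  have "b \<star> b \<star> c \<star> y = (b \<star> b \<star> c) \<star> y + (b \<star> c) \<star> b \<star> y + (b \<star> c) \<star> b \<star> y + c \<star> b \<star> b \<star> y"
    by (simp add: bracket_leibniz[of b c y] bracket_add_right bracket_leibniz[of b "b \<star> c" y]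
        bracket_leibniz[of b c "b \<star> y"])
  hence *: "f b (c \<star> y) \<odot> b = f b c \<odot> (b \<star> y) + (b \<star> c) \<star> b \<star> y + (b \<star> c) \<star> b \<star> y + f b y \<odot> (c \<star> b)"
    using b c y by (simp add: ext_square bracket_linear)
  thus 1: "(b \<star> c) \<star> b \<star> y + (b \<star> c) \<star> b \<star> y = f b (c \<star> y) \<odot> b - f b c \<odot> (b \<star> y) + f b y \<odot> (b \<star> c)"
    by (simp add: bracket_skew[of c b] scale_linear algebra_simps)
  have e: "b \<star> c \<star> b \<star> y = (b \<star> c) \<star> b \<star> y - f b y \<odot> (b \<star> c)"
    using b y by (simp add: bracket_leibniz[of b c "b \<star> y"] ext_square bracket_linear
        bracket_skew[of c b] scale_linear)
  show "b \<star> c \<star> b \<star> y + b \<star> c \<star> b \<star> y = f b (c \<star> y) \<odot> b - f b c \<odot> (b \<star> y) - f b y \<odot> (b \<star> c)"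
    unfolding e using 1 by (simp add: algebra_simps)
qed

text \<open>The exponential of ad x for extremal x: the square of ad x sends y to a multiple of x,
  so its cube vanishes and the series stops at the quadratic term.\<close>

definition Exp :: "'v \<Rightarrow> 'v \<Rightarrow> 'v" where
  "Exp x y = y + x \<star> y + (f x y / 2) \<odot> x"

lemma Exp_in [simp]: "ext x \<Longrightarrow> y \<in> L \<Longrightarrow> Exp x y \<in> L"
  by (auto simp: Exp_def)

text \<open>The linear terms agree by the Leibniz rule and the quadratic ones by the first identity
  in \<open>premet\<close>. The two cubic terms are opposite multiples of x and cancel, and the
  quartic one contains \<open>x \<star> x\<close>; hence no division by 3 occurs.\<close>

lemma Exp_bracket:
  assumes x: "ext x" and y: "y \<in> L" and z: "z \<in> L"
  shows "Exp x (y \<star> z) = Exp x y \<star> Exp x z"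
proof -
  obtain p where p: "f x y = p + p" by (rule half)
  obtain q where q: "f x z = q + q" by (rule half)
  obtain r where r: "f x (y \<star> z) = r + r" by (rule half)
  have hp [simp]: "(a + a) / 2 = a" for a :: 'k using two by (simp add: field_simps)
  have r': "r \<odot> x = (x \<star> y) \<star> x \<star> z + p \<odot> (x \<star> z) - q \<odot> (x \<star> y)"
  proof (rule double_cancel)
    show "r \<odot> x + r \<odot> x = ((x \<star> y) \<star> x \<star> z + p \<odot> (x \<star> z) - q \<odot> (x \<star> y))
       + ((x \<star> y) \<star> x \<star> z + p \<odot> (x \<star> z) - q \<odot> (x \<star> y))"
      using premet(1)[OF x y z] unfolding p q r by (simp add: scale_linear algebra_simps)
  qed
  have xyx: "(x \<star> y) \<star> x = - (p \<odot> x + p \<odot> x)"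
    using ext_square[OF x y] p by (simp add: bracket_skew[of "x \<star> y" x] scale_linear)
  show ?thesis unfolding Exp_def p q r hp
    by (simp add: r' xyx bracket_linear bracket_leibniz[of x y z] ext_square x z q bracket_skew[of y x]
        scale_linear algebra_simps)
qed

lemma f_self_ext [simp]: assumes "ext x" shows "f x x = 0"
proof (cases "x = 0")
  case False
  have "x \<star> x \<star> x = 0 \<odot> x" by (simp add: bracket_self)
  thus ?thesis using False assms by (intro f_eqI) auto
qed (use assms in auto)

lemma f_bracket_ext [simp]: assumes "ext x" "y \<in> L" shows "f x (x \<star> y) = 0"
proof (cases "x = 0")
  case False
  have "x \<star> x \<star> x \<star> y = 0 \<odot> x"
    by (subst ext_square[OF assms]) (simp add: bracket_linear)
  thus ?thesis using False assms by (intro f_eqI) auto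
qed (use assms in auto)

lemma half_minus: "- (c / 2) - c / 2 = - (c :: 'k)" "c / 2 + c / 2 = c"
  using two by (simp_all add: field_simps)

lemma Exp_minus: assumes "ext x" "y \<in> L" shows "Exp x (Exp (- x) y) = y"
proof -
  define p where "p = f x y / 2"
  have p: "f x y \<odot> x = p \<odot> x + p \<odot> x"
    by (simp add: p_def half_minus scale_left_distrib[symmetric])
  have "f x (Exp (- x) y) = f x y" "Exp (- x) y = y - x \<star> y + p \<odot> x"
    using assms by (simp_all add: Exp_def f_linear p_def)
  thus ?thesis using assms
    by (simp add: Exp_def[of x] p_def[symmetric] bracket_linear ext_square p)
qed

lemma Exp_scale: "x \<in> L \<Longrightarrow> y \<in> L \<Longrightarrow> Exp x (c \<odot> y) = c \<odot> Exp x y"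
  by (simp add: Exp_def bracket_linear f_linear scale_linear algebra_simps)

lemma Exp_square:
  assumes x: "ext x" and a: "ext a" and y: "y \<in> L"
  shows "Exp x a \<star> Exp x a \<star> Exp x y = f a y \<odot> Exp x a"
proof -
  have "Exp x a \<star> Exp x a \<star> Exp x y = Exp x (a \<star> a \<star> y)"
    using assms by (simp add: Exp_bracket)
  thus ?thesis using assms by (simp add: ext_square Exp_scale)
qed

text \<open>An automorphism carries extremal elements to extremal elements; the inverse
  \<open>Exp (- x)\<close> transports the test vector back.\<close>

lemma ext_Exp:
  assumes x: "ext x" and a: "ext a"
  shows "ext (Exp x a)"
proof (rule extI)
  fix y assume y: "y \<in> L"
  show "Exp x a \<star> Exp x a \<star> y = f a (Exp (- x) y) \<odot> Exp x a"
    using Exp_square[OF x a, of "Exp (- x) y"] Exp_minus[OF x y] ext_minus[OF x] y by simp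
qed (use assms in simp)

text \<open>The bracket of extremal x and a equals \<open>Exp x a - a\<close> up to a multiple of x,
  and all three are extremal. So the span of the extremal elements is already closed under
  brackets.\<close>

lemma span_ext: "L = span {x. ext x}"
proof
  let ?T = "span {x. ext x}"
  have TL: "?T \<subseteq> L"
    using L_sub by (intro span_minimal) (auto simp: lie_subalgebra_def)
  have br: "x \<star> a \<in> ?T" if x: "ext x" and a: "a \<in> ?T" for x a
    using a
  proof (induction rule: span_induct_alt)
    case base
    then show ?case by (simp add: span_zero)
  next
    case (step c a y)
    have "x \<star> a = Exp x a - a - (f x a / 2) \<odot> x" by (simp add: Exp_def)
    moreover have "\<dots> \<in> ?T"
      using x step(1) by (intro span_diff span_scale span_base) (auto intro: ext_Exp)
    ultimately show ?case using step by (simp add: bracket_linear span_add span_scale)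
  qed
  have "b \<star> a \<in> ?T" if b: "b \<in> ?T" and a: "a \<in> ?T" for a b
    using b
  proof (induction rule: span_induct_alt)
    case (step c x y)
    then show ?case using br[OF _ a] by (simp add: bracket_linear span_add span_scale)
  qed (simp add: span_zero)
  hence "lie_subalgebra smul bracket ?T" by (simp add: lie_subalgebra_def)
  hence "lie_generated smul bracket {x. ext x} \<subseteq> ?T"
    by (rule lie_generated_least) (rule span_superset)
  thus "L \<subseteq> ?T" using L_generated unfolding ext_def by blast
  show "?T \<subseteq> L" by (rule TL)
qed

section \<open>Symmetry and invariance of the form\<close>

lemma ext_induct [consumes 1, case_names zero step]:
  assumes "y \<in> L" "P 0" "\<And>c a b. ext a \<Longrightarrow> b \<in> L \<Longrightarrow> P b \<Longrightarrow> P (c \<odot> a + b)"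
  shows "P y"
proof -
  have "y \<in> span {x. ext x}" using assms(1) span_ext by simp
  hence "y \<in> L \<and> P y"
    by (induction rule: span_induct_alt) (use assms in auto)
  thus ?thesis ..
qed

text \<open>Both values are coefficients of one vector. Extremality of x evaluates
  \<open>y \<star> x \<star> x \<star> y\<close> to \<open>f x y\<close> times
  \<open>y \<star> x\<close>; moving the outer y inwards leaves \<open>f y x\<close> times the same
  vector, since \<open>(y \<star> x) \<star> x \<star> y\<close> is zero.\<close>

lemma f_sym_ext:
  assumes x: "ext x" and y: "ext y"
  shows "f x y = f y x"
proof (cases "x \<star> y = 0")
  case True
  hence "y \<star> x = 0" using bracket_skew[of y x] by simp
  then show ?thesis using True x y
    by (cases "x = 0"; cases "y = 0") (auto simp: f_eqI[where c=0])
next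
  case False
  have "f x y \<odot> (y \<star> x) = y \<star> x \<star> x \<star> y" using x y by (simp add: ext_square bracket_linear)
  also have "\<dots> = (y \<star> x) \<star> x \<star> y + x \<star> y \<star> x \<star> y" by (rule bracket_leibniz)
  also have "(y \<star> x) \<star> x \<star> y = 0" by (subst bracket_skew[of x y]) (simp add: bracket_self)
  also have "x \<star> y \<star> x \<star> y = - (x \<star> y \<star> y \<star> x)" by (subst bracket_skew[of x y]) simp
  also have "\<dots> = f y x \<odot> (y \<star> x)" using x y
    by (simp add: ext_square bracket_linear bracket_skew[of x y])
  finally show ?thesis using False bracket_skew[of y x] by simp
qed

lemma f_sym: assumes "x \<in> L" "y \<in> L" shows "f x y = f y x"
proof -
  have *: "f a y = f y a" if a: "ext a" for a
    using assms(2) by (induction rule: ext_induct) (use a in \<open>simp_all add: f_linear f_sym_ext\<close>)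
  show ?thesis
    using assms(1) by (induction rule: ext_induct) (use * assms in \<open>simp_all add: f_linear\<close>)
qed

text \<open>For extremal a, the value of \<open>f\<close> is determined by the extremal identity,
  which automorphisms preserve; the spanning property extends this to all of
  \<open>L\<close>.\<close>

lemma f_Exp:
  assumes x: "ext x" and a: "a \<in> L" and y: "y \<in> L"
  shows "f (Exp x a) (Exp x y) = f a y"
  using a
proof (induction rule: ext_induct)
  case zero
  then show ?case using x y by (simp add: Exp_def)
next
  case (step c a b)
  have "f (Exp x a) (Exp x y) = f a y"
  proof (cases "Exp x a = 0")
    case True
    have "Exp (- x) 0 = 0" using x by (simp add: Exp_def)
    moreover have "Exp (- x) (Exp x a) = a"
      using Exp_minus[OF ext_minus[OF x], of a] step by simp
    ultimately have "a = 0" using True by simp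
    thus ?thesis using True x y by simp
  next
    case False
    thus ?thesis using step x y by (intro f_eqI) (auto simp: ext_Exp Exp_square)
  qed
  moreover have "Exp x (c \<odot> a + b) = c \<odot> Exp x a + Exp x b"
    using x step by (simp add: Exp_def bracket_linear f_linear scale_linear algebra_simps add_divide_distrib)
  ultimately show ?case using step x y by (simp add: f_linear)
qed

text \<open>The infinitesimal form of \<open>f_Exp\<close>: \<open>f\<close> is preserved by
  \<open>Exp x\<close> and by \<open>Exp (- x)\<close>, and subtracting the two equations isolates
  the terms odd in x, which are twice the required sum.\<close>

lemma f_skew_ext:
  assumes x: "ext x" and a: "a \<in> L" and b: "b \<in> L"
  shows "f (x \<star> a) b = - f a (x \<star> b)"
proof -
  define p q where "p = f x a / 2" and "q = f x b / 2"
  have [simp]: "f a x = f x a" using f_sym[of x a] x a by simp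
  have [simp]: "f (x \<star> a) x = 0" using f_sym[of "x \<star> a" x] x a b by simp
  have "f (Exp x a) (Exp x b) = f (Exp (- x) a) (Exp (- x) b)"
    using f_Exp[OF x] f_Exp[OF ext_minus[OF x]] a b by simp
  moreover have "Exp x a = a + x \<star> a + p \<odot> x" "Exp x b = b + x \<star> b + q \<odot> x"
    "Exp (- x) a = a - x \<star> a + p \<odot> x" "Exp (- x) b = b - x \<star> b + q \<odot> x"
    using x a b by (simp_all add: Exp_def p_def q_def)
  ultimately have "2 * (f (x \<star> a) b + f a (x \<star> b)) = 0"
    using x a b by (simp add: f_linear algebra_simps)
  hence "f (x \<star> a) b + f a (x \<star> b) = 0" by (simp only: mult_eq_0_iff two simp_thms)
  thus ?thesis by (simp only: eq_neg_iff_add_eq_0)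
qed

lemma f_skew:
  assumes x: "x \<in> L" and a: "a \<in> L" and b: "b \<in> L"
  shows "f (x \<star> a) b = - f a (x \<star> b)"
  using x by (induction rule: ext_induct)
    (use a b in \<open>simp_all add: bracket_linear f_linear f_skew_ext\<close>)

lemma f_assoc: "a \<in> L \<Longrightarrow> b \<in> L \<Longrightarrow> c \<in> L \<Longrightarrow> f (a \<star> b) c = f a (b \<star> c)"
  using f_skew[of b a c] bracket_skew[of a b] by simp

lemma f_centralizer:
  assumes "x \<star> c = 0" "x \<in> L" "c \<in> L" "s \<in> L"
  shows "f x (c \<star> s) = 0"
  using f_assoc[of x c s] assms by simp

text \<open>Applying ad of \<open>x \<star> y\<close> twice gives four words of length four.
  Premet's identity evaluates the two alternating words, where \<open>f x y = 0\<close> removes the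
  unwanted term, and extremality evaluates the other two. All are multiples of
  \<open>x \<star> y\<close>.\<close>

lemma ext_bracket:
  assumes x: "ext x" and y: "ext y" and xy: "f x y = 0"
  shows "ext (x \<star> y)"
proof (rule extI)
  fix v assume v: "v \<in> L"
  let ?z = "x \<star> y"
  obtain p where p: "f x (y \<star> v) = p + p" by (rule half)
  have "f y (x \<star> v) = - f x (y \<star> v)"
    using f_assoc[of y x v] f_skew[of y x v] x y v by simp
  hence q: "f y (x \<star> v) = - p - p" using p by simp
  have yx: "f y x = 0" using xy f_sym[of x y] x y by simp
  have 1: "x \<star> y \<star> x \<star> y \<star> v = - (p \<odot> ?z)"
    by (rule double_cancel)
      (use premet(2)[of x y "y \<star> v"] x y v p in \<open>simp add: xy ext_square f_linear scale_linear\<close>)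
  have 2: "y \<star> x \<star> y \<star> x \<star> v = - (p \<odot> ?z)"
    by (rule double_cancel)
      (use premet(2)[of y x "x \<star> v"] x y v q in
        \<open>simp add: yx ext_square f_linear scale_linear bracket_skew[of y x]\<close>)
  have "?z \<star> ?z \<star> v = x \<star> y \<star> x \<star> y \<star> v - x \<star> y \<star> y \<star> x \<star> v - y \<star> x \<star> x \<star> y \<star> v + y \<star> x \<star> y \<star> x \<star> v"
    by (simp add: bracket_bracket bracket_diff)
  also have "\<dots> = (p + p) \<odot> ?z"
    using x y v p q by (simp add: 1 2 ext_square bracket_linear bracket_skew[of y x] scale_linear)
  finally show "?z \<star> ?z \<star> v = (\<lambda>v. f x (y \<star> v)) v \<odot> ?z" using p by simp
qed (use x y in simp)

end

section \<open>Systems of matrix units\<close>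

context lie_algebra
begin

definition offdiag :: "('i \<Rightarrow> 'i \<Rightarrow> 'v) \<Rightarrow> 'i set \<Rightarrow> 'v set" where
  "offdiag e I = {e i j | i j. i \<in> I \<and> j \<in> I \<and> i \<noteq> j}"

text \<open>The third clause fixes the relative scale of opposite root vectors. It is what describes
  \<open>sl\<close> with two indices, where the first clause is vacuous and the second only says
  that an element commutes with itself.\<close>

definition steinberg :: "'i set \<Rightarrow> ('i \<Rightarrow> 'i \<Rightarrow> 'v) \<Rightarrow> bool" where
  "steinberg I e \<longleftrightarrow>
     (\<forall>i\<in>I. \<forall>j\<in>I. \<forall>k\<in>I. i \<noteq> j \<longrightarrow> j \<noteq> k \<longrightarrow> i \<noteq> k \<longrightarrow> e i j \<star> e j k = e i k) \<and>
     (\<forall>i\<in>I. \<forall>j\<in>I. \<forall>k\<in>I. \<forall>l\<in>I. i \<noteq> j \<longrightarrow> k \<noteq> l \<longrightarrow> j \<noteq> k \<longrightarrow> i \<noteq> l \<longrightarrow> e i j \<star> e k l = 0) \<and>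
     (\<forall>i\<in>I. \<forall>j\<in>I. i \<noteq> j \<longrightarrow> (e i j \<star> e j i) \<star> e i j = e i j + e i j)"

lemma steinberg_mult:
  "steinberg I e \<Longrightarrow> i \<in> I \<Longrightarrow> j \<in> I \<Longrightarrow> k \<in> I \<Longrightarrow> i \<noteq> j \<Longrightarrow> j \<noteq> k \<Longrightarrow> i \<noteq> k \<Longrightarrow> e i j \<star> e j k = e i k"
  unfolding steinberg_def by blast

lemma steinberg_mult':
  "steinberg I e \<Longrightarrow> i \<in> I \<Longrightarrow> j \<in> I \<Longrightarrow> k \<in> I \<Longrightarrow> i \<noteq> j \<Longrightarrow> j \<noteq> k \<Longrightarrow> i \<noteq> k \<Longrightarrow> e j k \<star> e i j = - e i k"
  using steinberg_mult[of I e i j k] bracket_skew[of "e j k" "e i j"] by simp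

lemma steinberg_commute:
  "steinberg I e \<Longrightarrow> i \<in> I \<Longrightarrow> j \<in> I \<Longrightarrow> k \<in> I \<Longrightarrow> l \<in> I \<Longrightarrow>
     i \<noteq> j \<Longrightarrow> k \<noteq> l \<Longrightarrow> j \<noteq> k \<Longrightarrow> i \<noteq> l \<Longrightarrow> e i j \<star> e k l = 0"
  unfolding steinberg_def by blast

lemma steinberg_square:
  "steinberg I e \<Longrightarrow> i \<in> I \<Longrightarrow> j \<in> I \<Longrightarrow> i \<noteq> j \<Longrightarrow> (e i j \<star> e j i) \<star> e i j = e i j + e i j"
  unfolding steinberg_def by blast

lemma steinberg_square':
  assumes "steinberg I e" "i \<in> I" "j \<in> I" "i \<noteq> j"
  shows "(e i j \<star> e j i) \<star> e j i = - (e j i + e j i)"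
  using steinberg_square[of I e j i] assms bracket_skew[of "e i j" "e j i"] by simp

text \<open>A third index k supplies the scale: \<open>e i j \<star> e j i\<close> fixes both
  \<open>e i k\<close> and \<open>e k j\<close>, and, acting as a derivation, it doubles their
  bracket \<open>e i j\<close>.\<close>

lemma steinbergI:
  assumes mult: "\<And>i j k. i \<in> I \<Longrightarrow> j \<in> I \<Longrightarrow> k \<in> I \<Longrightarrow> i \<noteq> j \<Longrightarrow> j \<noteq> k \<Longrightarrow> i \<noteq> k \<Longrightarrow> e i j \<star> e j k = e i k"
    and comm: "\<And>i j k l. i \<in> I \<Longrightarrow> j \<in> I \<Longrightarrow> k \<in> I \<Longrightarrow> l \<in> I \<Longrightarrow>
      i \<noteq> j \<Longrightarrow> k \<noteq> l \<Longrightarrow> j \<noteq> k \<Longrightarrow> i \<noteq> l \<Longrightarrow> e i j \<star> e k l = 0"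
    and third: "\<And>i j. i \<in> I \<Longrightarrow> j \<in> I \<Longrightarrow> \<exists>k\<in>I. k \<noteq> i \<and> k \<noteq> j"
  shows "steinberg I e"
proof -
  have square: "(e i j \<star> e j i) \<star> e i j = e i j + e i j"
    if ij: "i \<in> I" "j \<in> I" "i \<noteq> j" for i j
  proof -
    obtain k where k: "k \<in> I" "k \<noteq> i" "k \<noteq> j" using third[of i j] ij by blast
    have "e j i \<star> e i k = e j k" "e i j \<star> e j k = e i k" "e k j \<star> e j i = e k i"
      "e k i \<star> e i j = e k j" "e i k \<star> e k j = e i j"
      by (rule mult; use ij k in blast)+
    note m = this
    have c: "e i j \<star> e i k = 0" "e i j \<star> e k j = 0"
      by (rule comm; use ij k in blast)+
    have 1: "(e i j \<star> e j i) \<star> e i k = e i k"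
      by (simp add: bracket_bracket m c)
    have "e j i \<star> e k j = - e k i" "e i j \<star> e k i = - e k j"
      using m(3,4) bracket_skew by metis+
    hence 2: "(e i j \<star> e j i) \<star> e k j = e k j"
      by (simp add: bracket_bracket c)
    have "(e i j \<star> e j i) \<star> (e i k \<star> e k j) = e i k \<star> e k j + e i k \<star> e k j"
      by (subst bracket_leibniz) (simp only: 1 2)
    thus ?thesis by (simp only: m)
  qed
  show ?thesis unfolding steinberg_def
    by (intro conjI ballI impI) (rule mult comm square; assumption)+
qed

text \<open>\<open>diag_ext b e i i\<close> stands for the matrix unit difference \<open>E\<^sub>i\<^sub>i - E\<^sub>b\<^sub>b\<close>.\<close>

definition diag_ext :: "'i \<Rightarrow> ('i \<Rightarrow> 'i \<Rightarrow> 'v) \<Rightarrow> 'i \<Rightarrow> 'i \<Rightarrow> 'v" where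
  "diag_ext b e i j = (if i \<noteq> j then e i j else if i = b then 0 else e i b \<star> e b i)"

lemma diag_ext_off: "i \<noteq> j \<Longrightarrow> diag_ext b e i j = e i j"
  by (simp add: diag_ext_def)

text \<open>Expanding \<open>e i j\<close> as \<open>e i b \<star> e b j\<close> expresses every
  Cartan element through those based at the single index b.\<close>

lemma steinberg_opposite:
  assumes st: "steinberg I e" and I: "i \<in> I" "j \<in> I" "b \<in> I" "i \<noteq> j"
  shows "e i j \<star> e j i = diag_ext b e i i - diag_ext b e j j"
proof -
  consider "i = b" | "j = b" | "i \<noteq> b" "j \<noteq> b" by blast
  then show ?thesis
  proof cases
    case 1
    have "e i j \<star> e j i = - (e j i \<star> e i j)" by (rule bracket_skew)
    then show ?thesis using I 1 by (simp add: diag_ext_def)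
  next
    case 2
    then show ?thesis using I by (simp add: diag_ext_def)
  next
    case 3
    have "e i j \<star> e j i = (e i b \<star> e b j) \<star> e j i"
      using steinberg_mult[OF st, of i b j] I 3 by simp
    also have "\<dots> = e i b \<star> e b i + e b j \<star> e j b"
      using steinberg_mult[OF st, of b j i] steinberg_mult'[OF st, of j i b] I 3
      by (simp add: bracket_bracket)
    also have "e b j \<star> e j b = - (e j b \<star> e b j)" by (rule bracket_skew)
    finally show ?thesis using I 3 by (simp add: diag_ext_def)
  qed
qed

lemma steinberg_cartan:
  assumes st: "steinberg I e" and I: "i \<in> I" "j \<in> I" "k \<in> I" "l \<in> I" "i \<noteq> j" "k \<noteq> l"
  shows "(e i j \<star> e j i) \<star> e k l =
    (if i = k then e k l else 0) - (if j = k then e k l else 0)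
    - (if i = l then e k l else 0) + (if j = l then e k l else 0)"
proof -
  note m = steinberg_mult[OF st] and m' = steinberg_mult'[OF st] and c = steinberg_commute[OF st]
  consider "k = i" "l = j" | "k = j" "l = i" | "k = i" "l \<noteq> j" | "k = j" "l \<noteq> i"
    | "k \<noteq> i" "k \<noteq> j" "l = i" | "k \<noteq> i" "k \<noteq> j" "l = j" | "k \<noteq> i" "k \<noteq> j" "l \<noteq> i" "l \<noteq> j"
    using I by blast
  then show ?thesis
  proof cases
    case 1
    show ?thesis using steinberg_square[OF st, of i j] 1 I by (simp del: bracket_minus)
  next
    case 2
    show ?thesis using steinberg_square'[OF st, of i j] 2 I by simp
  qed (use I in \<open>simp_all add: bracket_bracket[of "e i j" "e j i"] m m' c\<close>)
qed

text \<open>The first line is the usual bracket of matrix units. The second and third are the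
  contributions of the summands -E_bb hidden in the diagonal entries of the left and of the right
  factor.\<close>

lemma diag_ext_bracket:
  assumes st: "steinberg I e" and I: "i \<in> I" "j \<in> I" "k \<in> I" "l \<in> I" "b \<in> I"
  defines "E \<equiv> diag_ext b e"
  shows "E i j \<star> E k l =
    (if j = k then E i l else 0) - (if i = l then E k j else 0)
    - (if i = j then (if b = k then E b l else 0) - (if b = l then E k b else 0) else 0)
    + (if k = l then (if b = i then E b j else 0) - (if b = j then E i b else 0) else 0)"
proof -
  have dd: "E i i \<star> e k l = (if i = k then e k l else 0) - (if b = k then e k l else 0)
      - (if i = l then e k l else 0) + (if b = l then e k l else 0)"
    if "i \<in> I" "k \<in> I" "l \<in> I" "k \<noteq> l" for i k l
  proof (cases "i = b")
    case False
    hence "E i i = e i b \<star> e b i" by (simp add: E_def diag_ext_def)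
    thus ?thesis using steinberg_cartan[OF st, of i b k l] that I(5) False by simp
  qed (simp add: E_def diag_ext_def)
  have bb: "E b b = 0" by (simp add: E_def diag_ext_def)
  have off: "i \<noteq> j \<Longrightarrow> E i j = e i j" for i j by (simp add: E_def diag_ext_off)
  consider "i = j" "k = l" | "i = j" "k \<noteq> l" | "i \<noteq> j" "k = l" | "i \<noteq> j" "k \<noteq> l" by blast
  then show ?thesis
  proof cases
    case 1
    have "E i i \<star> E k k = 0"
    proof (cases "k = b")
      case False
      have "E i i \<star> E k k = E i i \<star> e k b \<star> e b k" using False by (simp add: E_def diag_ext_def)
      also have "\<dots> = (E i i \<star> e k b) \<star> e b k + e k b \<star> E i i \<star> e b k" by (rule bracket_leibniz)
      also have "\<dots> = 0"
        using dd[of i k b] dd[of i b k] I False by (auto simp: bracket_linear)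
      finally show ?thesis .
    qed (simp add: bb)
    thus ?thesis using 1 bb by auto
  next
    case 2
    then show ?thesis using dd[of i k l] I off[of k l] bb by (auto simp: off)
  next
    case 3
    have "E i j \<star> E k l = - (E k k \<star> e i j)" using 3 by (subst bracket_skew) (simp add: off)
    then show ?thesis using 3 dd[of k i j] I off[of i j] bb by (auto simp: off)
  next
    case 4
    show ?thesis
    proof (cases "j = k \<and> i = l")
      case True
      then show ?thesis using 4 steinberg_opposite[OF st, of i j b] I by (simp add: diag_ext_off E_def)
    next
      case False
      then show ?thesis
        using 4 steinberg_mult[OF st, of i j l] steinberg_mult'[OF st, of k l j]
          steinberg_commute[OF st, of i j k l] I by (auto simp: off)
    qed
  qed
qed

section \<open>The linear map from matrices defined by a system of matrix units\<close>

definition matrix_sum :: "'i set \<Rightarrow> ('i \<Rightarrow> 'i \<Rightarrow> 'v) \<Rightarrow> ('i \<Rightarrow> 'i \<Rightarrow> 'k) \<Rightarrow> 'v" where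
  "matrix_sum I E A = (\<Sum>i\<in>I. \<Sum>j\<in>I. A i j \<odot> E i j)"

lemma bracket_sum: "sum g S \<star> y = (\<Sum>i\<in>S. g i \<star> y)" "y \<star> sum g S = (\<Sum>i\<in>S. y \<star> g i)"
  by (induction S rule: infinite_finite_induct; simp add: bracket_linear)+

lemma matrix_sum_add:
  "matrix_sum I E (\<lambda>i j. A i j + B i j) = matrix_sum I E A + matrix_sum I E B"
  by (simp add: matrix_sum_def scale_left_distrib sum.distrib)

lemma matrix_sum_scale: "matrix_sum I E (\<lambda>i j. c * A i j) = c \<odot> matrix_sum I E A"
  by (simp add: matrix_sum_def scale_sum_right)

text \<open>Summed over all entries, the two corrections of \<open>diag_ext_bracket\<close> acquire
  the traces of \<open>A\<close> and of \<open>B\<close> as factors. On trace-zero matrices only the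
  commutator survives, and the relations alone suffice for this.\<close>

lemma matrix_sum_bracket:
  assumes st: "steinberg I e" and fin: "finite I" and b: "b \<in> I"
    and A: "(\<Sum>i\<in>I. A i i) = 0" and B: "(\<Sum>i\<in>I. B i i) = 0"
  shows "matrix_sum I (diag_ext b e) A \<star> matrix_sum I (diag_ext b e) B =
    matrix_sum I (diag_ext b e) (\<lambda>i l. (\<Sum>j\<in>I. A i j * B j l) - (\<Sum>j\<in>I. B i j * A j l))"
    (is "?lhs = ?rhs")
proof -
  define E where "E = diag_ext b e"
  define R where "R i j = (if b = i then E b j else 0) - (if b = j then E i b else 0)" for i j
  have scale_if: "c \<odot> (if P then v else 0) = (if P then c \<odot> v else 0)" for c P v by simp
  have sum_if: "(\<Sum>k\<in>I. if P then g k else 0) = (if P then sum g I else 0)" for P and g :: "_ \<Rightarrow> 'v"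
    by simp
  have "?lhs = (\<Sum>i\<in>I. \<Sum>j\<in>I. \<Sum>k\<in>I. \<Sum>l\<in>I. (A i j * B k l) \<odot> (E i j \<star> E k l))"
    by (simp only: matrix_sum_def bracket_sum(1))
      (simp only: bracket_sum(2) bracket_scale_left bracket_scale_right scale_scale E_def mult.commute)
  also have "\<dots> = (\<Sum>i\<in>I. \<Sum>j\<in>I. \<Sum>k\<in>I. \<Sum>l\<in>I.
      (if j = k then (A i j * B k l) \<odot> E i l else 0) - (if i = l then (A i j * B k l) \<odot> E k j else 0)
      - (if i = j then (A i j * B k l) \<odot> R k l else 0) + (if k = l then (A i j * B k l) \<odot> R i j else 0))"
  proof (intro sum.cong refl)
    fix i j k l assume "i \<in> I" "j \<in> I" "k \<in> I" "l \<in> I"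
    from diag_ext_bracket[OF st this b]
    have "E i j \<star> E k l = (if j = k then E i l else 0) - (if i = l then E k j else 0)
      - (if i = j then R k l else 0) + (if k = l then R i j else 0)"
      by (simp only: E_def R_def)
    thus "(A i j * B k l) \<odot> (E i j \<star> E k l) =
      (if j = k then (A i j * B k l) \<odot> E i l else 0) - (if i = l then (A i j * B k l) \<odot> E k j else 0)
      - (if i = j then (A i j * B k l) \<odot> R k l else 0) + (if k = l then (A i j * B k l) \<odot> R i j else 0)"
      by (simp only: scale_right_distrib scale_right_diff_distrib scale_if)
  qed
  also have "\<dots> = (\<Sum>i\<in>I. \<Sum>j\<in>I. \<Sum>k\<in>I. \<Sum>l\<in>I. if j = k then (A i j * B k l) \<odot> E i l else 0)
      - (\<Sum>i\<in>I. \<Sum>j\<in>I. \<Sum>k\<in>I. \<Sum>l\<in>I. if i = l then (A i j * B k l) \<odot> E k j else 0)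
      - (\<Sum>i\<in>I. \<Sum>j\<in>I. \<Sum>k\<in>I. \<Sum>l\<in>I. if i = j then (A i j * B k l) \<odot> R k l else 0)
      + (\<Sum>i\<in>I. \<Sum>j\<in>I. \<Sum>k\<in>I. \<Sum>l\<in>I. if k = l then (A i j * B k l) \<odot> R i j else 0)"
    (is "_ = ?s1 - ?s2 - ?s3 + ?s4") by (simp only: sum.distrib sum_subtractf)
  also have "?s4 = 0"
  proof -
    have "?s4 = (\<Sum>i\<in>I. \<Sum>j\<in>I. (A i j * (\<Sum>k\<in>I. B k k)) \<odot> R i j)"
      using fin by (simp add: scale_sum_left sum_distrib_left cong: sum.cong)
    thus ?thesis by (simp add: B)
  qed
  also have "?s3 = 0"
  proof -
    have "?s3 = (\<Sum>i\<in>I. \<Sum>k\<in>I. \<Sum>l\<in>I. (A i i * B k l) \<odot> R k l)"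
      using fin by (simp add: sum_if cong: sum.cong)
    also have "\<dots> = (\<Sum>k\<in>I. \<Sum>i\<in>I. \<Sum>l\<in>I. (A i i * B k l) \<odot> R k l)"
      by (rule sum.swap)
    also have "\<dots> = (\<Sum>k\<in>I. \<Sum>l\<in>I. \<Sum>i\<in>I. (A i i * B k l) \<odot> R k l)"
      by (intro sum.cong refl sum.swap)
    also have "\<dots> = (\<Sum>k\<in>I. \<Sum>l\<in>I. ((\<Sum>i\<in>I. A i i) * B k l) \<odot> R k l)"
      by (simp only: scale_sum_left sum_distrib_right)
    finally show ?thesis by (simp add: A)
  qed
  also have "?s1 = (\<Sum>i\<in>I. \<Sum>j\<in>I. \<Sum>l\<in>I. (A i j * B j l) \<odot> E i l)"
    using fin by (simp add: sum_if cong: sum.cong)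
  also have "\<dots> = (\<Sum>i\<in>I. \<Sum>l\<in>I. (\<Sum>j\<in>I. A i j * B j l) \<odot> E i l)"
    by (simp only: scale_sum_left, rule sum.cong[OF refl], rule sum.swap)
  also have "?s2 = (\<Sum>i\<in>I. \<Sum>j\<in>I. \<Sum>k\<in>I. (A i j * B k i) \<odot> E k j)"
    using fin by (simp cong: sum.cong)
  also have "\<dots> = (\<Sum>i\<in>I. \<Sum>k\<in>I. \<Sum>j\<in>I. (A i j * B k i) \<odot> E k j)"
    by (intro sum.cong refl sum.swap)
  also have "\<dots> = (\<Sum>k\<in>I. \<Sum>i\<in>I. \<Sum>j\<in>I. (A i j * B k i) \<odot> E k j)"
    by (rule sum.swap)
  also have "\<dots> = (\<Sum>k\<in>I. \<Sum>j\<in>I. (\<Sum>i\<in>I. B k i * A i j) \<odot> E k j)"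
    by (simp only: scale_sum_left mult.commute, rule sum.cong[OF refl], rule sum.swap)
  finally show ?thesis
    by (simp add: matrix_sum_def scale_left_diff_distrib sum_subtractf E_def)
qed

lemma diag_ext_generated:
  assumes "i \<in> I" "j \<in> I" "b \<in> I"
  shows "diag_ext b e i j \<in> lie_generated smul bracket (offdiag e I)"
proof -
  note S = lie_subalgebraD[OF lie_generated_subalgebra[of "offdiag e I"]]
  have "e i j \<in> lie_generated smul bracket (offdiag e I)" if "i \<in> I" "j \<in> I" "i \<noteq> j" for i j
    by (rule subsetD[OF lie_generated_superset]) (use that in \<open>auto simp: offdiag_def\<close>)
  thus ?thesis using assms S by (auto simp: diag_ext_def)
qed

lemma matrix_sum_generated:
  assumes "b \<in> I"
  shows "matrix_sum I (diag_ext b e) A \<in> lie_generated smul bracket (offdiag e I)"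
  unfolding matrix_sum_def
  using assms by (intro lie_subalgebraD[OF lie_generated_subalgebra] diag_ext_generated)

lemma matrix_sum_unit:
  assumes "finite I" "k \<in> I" "l \<in> I"
  shows "matrix_sum I E (\<lambda>i j. if i = k \<and> j = l then 1 else 0) = E k l"
proof -
  have "matrix_sum I E (\<lambda>i j. if i = k \<and> j = l then 1 else 0) =
     (\<Sum>i\<in>I. if i = k then (\<Sum>j\<in>I. if j = l then E i j else 0) else 0)"
    unfolding matrix_sum_def by (intro sum.cong refl) (auto intro!: sum.cong sum.neutral)
  thus ?thesis using assms by simp
qed

text \<open>The images of trace-zero matrices form a subalgebra, because a commutator has trace
  zero; it contains every off-diagonal unit and lies in what they generate.\<close>

lemma lie_generated_offdiag:
  assumes st: "steinberg I e" and fin: "finite I" and b: "b \<in> I"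
  shows "lie_generated smul bracket (offdiag e I) =
    matrix_sum I (diag_ext b e) ` {A. (\<Sum>i\<in>I. A i i) = 0}" (is "_ = ?T")
proof
  have sub: "subspace ?T"
  proof (rule subspaceI)
    show "0 \<in> ?T" by (rule image_eqI[where x = "\<lambda>_ _. 0"]) (simp_all add: matrix_sum_def)
  next
    fix x y assume "x \<in> ?T" "y \<in> ?T"
    then show "x + y \<in> ?T"
      by (auto simp: matrix_sum_add[symmetric] sum.distrib)
  next
    fix c x assume "x \<in> ?T"
    then show "c \<odot> x \<in> ?T"
      by (auto simp: matrix_sum_scale[symmetric] sum_distrib_left[symmetric])
  qed
  have tr: "(\<Sum>i\<in>I. (\<Sum>j\<in>I. A i j * B j i) - (\<Sum>j\<in>I. B i j * A j i)) = 0" for A B :: "_ \<Rightarrow> _ \<Rightarrow> 'k"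
    by (subst sum_subtractf, subst sum.swap) (simp add: mult.commute)
  have "lie_subalgebra smul bracket ?T"
    unfolding lie_subalgebra_def using sub
    by (auto simp: matrix_sum_bracket[OF st fin b] tr)
  moreover have "offdiag e I \<subseteq> ?T"
  proof
    fix y assume "y \<in> offdiag e I"
    then obtain k l where kl: "y = e k l" "k \<in> I" "l \<in> I" "k \<noteq> l" by (auto simp: offdiag_def)
    show "y \<in> ?T"
    proof (rule image_eqI)
      show "y = matrix_sum I (diag_ext b e) (\<lambda>i j. if i = k \<and> j = l then 1 else 0)"
        using kl fin by (simp add: matrix_sum_unit diag_ext_off)
      show "(\<lambda>i j. if i = k \<and> j = l then 1 else 0) \<in> {A. (\<Sum>i\<in>I. A i i) = (0::'k)}"
        using kl by (auto intro!: sum.neutral)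
    qed
  qed
  ultimately show "lie_generated smul bracket (offdiag e I) \<subseteq> ?T" by (rule lie_generated_least)
  show "?T \<subseteq> lie_generated smul bracket (offdiag e I)"
    using b by (auto intro: matrix_sum_generated)
qed

end

section \<open>Adding one generator\<close>

text \<open>The old indices are \<open>insert u J\<close>: \<open>x\<close> commutes with the root
  vectors inside \<open>J\<close> and interacts only with those involving \<open>u\<close>. A
  one-element \<open>J\<close> makes the commutation assumption void, which is the case of
  \<open>sl\<close> of size 2. The index \<open>r\<close> is a fixed reference for formulas at
  \<open>u\<close>, and the value 2 is the one taken by the model matrix.\<close>

locale extension_step = extremal_algebra smul bracket L f
  for smul :: "'k::field \<Rightarrow> 'v::ab_group_add \<Rightarrow> 'v" (infixr "\<odot>" 75)
    and bracket :: "'v \<Rightarrow> 'v \<Rightarrow> 'v" (infixr "\<star>" 70)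
    and L :: "'v set" and f :: "'v \<Rightarrow> 'v \<Rightarrow> 'k" +
  fixes J :: "'i set" and u :: 'i and r :: 'i and e :: "'i \<Rightarrow> 'i \<Rightarrow> 'v" and x :: 'v
  assumes r_in: "r \<in> J"
    and u_notin: "u \<notin> J"
    and e_steinberg: "steinberg (insert u J) e"
    and e_ext: "i \<in> insert u J \<Longrightarrow> j \<in> insert u J \<Longrightarrow> i \<noteq> j \<Longrightarrow> ext (e i j)"
    and x_ext: "ext x"
    and x_commute: "i \<in> J \<Longrightarrow> j \<in> J \<Longrightarrow> i \<noteq> j \<Longrightarrow> e i j \<star> x = 0"
    and f_col: "i \<in> J \<Longrightarrow> f x (e i u) = 0"
    and f_row: "i \<in> J \<Longrightarrow> f x (e u i) = 0"
    and f_cartan: "i \<in> J \<Longrightarrow> f x (e i u \<star> e u i) = 2"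
begin

text \<open>In the enlarged matrix algebra with the new index \<open>m\<close>, \<open>x\<close> plays the part of
  \<open>E\<^sub>u\<^sub>u - E\<^sub>u\<^sub>m + E\<^sub>m\<^sub>u - E\<^sub>m\<^sub>m\<close>, while \<open>new_col i\<close> and \<open>new_row i\<close>
  play those of \<open>E\<^sub>i\<^sub>m\<close> and \<open>E\<^sub>m\<^sub>i\<close>. The transposition below exchanges the two.\<close>

definition new_col :: "'i \<Rightarrow> 'v" where
  "new_col i = (if i = u then e u r \<star> (e r u - e r u \<star> x) else e i u - e i u \<star> x)"

definition new_row :: "'i \<Rightarrow> 'v" where
  "new_row i = (if i = u then - ((e u r + e u r \<star> x) \<star> e r u) else - (e u i + e u i \<star> x))"

lemma in_L [simp]: "x \<in> L" "i \<in> J \<Longrightarrow> e i u \<in> L" "i \<in> J \<Longrightarrow> e u i \<in> L"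
    "i \<in> J \<Longrightarrow> j \<in> J \<Longrightarrow> i \<noteq> j \<Longrightarrow> e i j \<in> L"
  using x_ext e_ext u_notin by blast+

lemma neq [simp]: "i \<in> J \<Longrightarrow> i \<noteq> u" "i \<in> J \<Longrightarrow> u \<noteq> i"
  using u_notin by auto

lemma ext_b [simp]: "i \<in> J \<Longrightarrow> ext (e i u)" and ext_c [simp]: "i \<in> J \<Longrightarrow> ext (e u i)"
  using e_ext u_notin by auto

text \<open>Minus the transpose is an automorphism of \<open>sl\<close>. Combined with a change of
  sign at the new index it sends the model matrix to its negative, whence \<open>- x\<close>.
  Statements on rows are then instances of those on columns.\<close>

lemma transpose: "extension_step smul bracket L f J u r (\<lambda>i j. - e j i) (- x)"
proof -
  have st: "steinberg (insert u J) (\<lambda>i j. - e j i)"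
    unfolding steinberg_def
  proof (intro conjI ballI impI)
    fix i j k assume "i \<in> insert u J" "j \<in> insert u J" "k \<in> insert u J" "i \<noteq> j" "j \<noteq> k" "i \<noteq> k"
    thus "- e j i \<star> - e k j = - e k i" using steinberg_mult'[OF e_steinberg, of k j i] by simp
  next
    fix i j assume ij: "i \<in> insert u J" "j \<in> insert u J" "i \<noteq> j"
    have "- e j i \<star> - e i j = - (e i j \<star> e j i)" using bracket_skew[of "e j i" "e i j"] by simp
    thus "(- e j i \<star> - e i j) \<star> - e j i = - e j i + - e j i"
      using steinberg_square'[OF e_steinberg, of i j] ij by simp
  qed (use steinberg_commute[OF e_steinberg] in simp)
  have "f x (e u i \<star> e i u) = - 2" if "i \<in> J" for i
    using f_cartan[OF that] bracket_skew[of "e u i" "e i u"] that by simp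
  thus ?thesis
    using extremal_algebra_axioms r_in u_notin st x_ext x_commute f_col f_row e_ext
    by (unfold_locales) (auto intro!: ext_minus)
qed

section \<open>Words in the old root vectors applied to the new generator\<close>

lemma bx: "i \<in> J \<Longrightarrow> f (e i u) x = 0"
  using f_col f_sym[of "e i u" x] by simp

text \<open>For distinct indices, \<open>e i u\<close> and \<open>e j u\<close> commute, so the two
  orders agree on \<open>x\<close>. On the other hand \<open>e j i\<close> kills \<open>x\<close>
  and carries \<open>e i u\<close> to \<open>e j u\<close>; as the square of ad \<open>e i u\<close>
  also kills \<open>x\<close>, the two orders are opposite. Hence twice the value is zero.\<close>

lemma col_col_x: assumes "i \<in> J" "j \<in> J" shows "e i u \<star> e j u \<star> x = 0"
proof (cases "i = j")
  case True
  then show ?thesis using assms by (simp add: ext_square bx)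
next
  case False
  let ?bi = "e i u" and ?bj = "e j u" and ?d = "e j i"
  have d: "?d \<star> ?bi = ?bj" using steinberg_mult[OF e_steinberg, of j i u] assms False by simp
  have dx: "?d \<star> x = 0" using x_commute assms False by simp
  have "?bj \<star> x = ?d \<star> ?bi \<star> x" unfolding d[symmetric] by (simp add: bracket_bracket dx)
  hence "?bi \<star> ?bj \<star> x = (?bi \<star> ?d) \<star> ?bi \<star> x + ?d \<star> ?bi \<star> ?bi \<star> x"
    by (simp add: bracket_leibniz[of ?bi ?d])
  also have "?bi \<star> ?d = - ?bj" using bracket_skew[of ?bi ?d] d by simp
  also have "?bi \<star> ?bi \<star> x = 0" using assms by (simp add: ext_square bx)
  finally have 1: "?bi \<star> ?bj \<star> x = - (?bj \<star> ?bi \<star> x)" by simp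
  have "?bi \<star> ?bj = 0" using steinberg_commute[OF e_steinberg, of i u j u] assms False by simp
  hence 2: "?bi \<star> ?bj \<star> x = ?bj \<star> ?bi \<star> x" using bracket_leibniz[of ?bi ?bj x] by simp
  show ?thesis
    by (rule double_cancel) (use 1[folded 2] in \<open>simp only: eq_neg_iff_add_eq_0 add_0\<close>)
qed

lemma row_row_x: assumes "i \<in> J" "j \<in> J" shows "e u i \<star> e u j \<star> x = 0"
  using extension_step.col_col_x[OF transpose assms] by simp

lemma f_col_row: assumes "i \<in> J" shows "f (e i u) (e u i) = - 2"
proof -
  have "f x (e i u \<star> e u i) \<noteq> f x 0" using f_cartan[OF assms] by simp
  hence nz: "e i u \<noteq> 0" by auto
  have "e i u \<star> e i u \<star> e u i = - (e i u + e i u)"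
    using steinberg_square[OF e_steinberg, of i u] assms bracket_skew[of "e i u" "e i u \<star> e u i"] by simp
  also have "\<dots> = (- 2) \<odot> e i u" by (simp add: scale_two)
  finally show ?thesis using nz assms by (intro f_eqI) auto
qed

lemma f_row_col: assumes "i \<in> J" shows "f (e u i) (e i u) = - 2"
  using f_col_row[OF assms] f_sym[of "e u i" "e i u"] assms by simp

lemma f_col_row_x: assumes "i \<in> J" shows "f (e i u) (e u i \<star> x) = 2"
  using f_assoc[of "e i u" "e u i" x] f_sym[of "e i u \<star> e u i" x] f_cartan[OF assms] assms by simp

lemma f_row_col_x: assumes "i \<in> J" shows "f (e u i) (e i u \<star> x) = - 2"
  using f_skew[of "e i u" "e u i" x] f_assoc[of "e i u" "e u i" x] f_col_row_x[OF assms] assms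
  by (simp add: minus_equation_iff[of "f (e u i) (e i u \<star> x)"])

definition h :: "'i \<Rightarrow> 'v" where "h i = e i u \<star> e u i"

lemma h_col: "i \<in> J \<Longrightarrow> h i \<star> e i u = e i u + e i u"
  unfolding h_def by (rule steinberg_square[OF e_steinberg]) auto

lemma h_in [simp]: "i \<in> J \<Longrightarrow> h i \<in> L" by (simp add: h_def)

lemma h_diff:
  assumes "i \<in> J" "j \<in> J" "i \<noteq> j"
  shows "e i j \<star> e j i = h i - h j"
  using steinberg_opposite[OF e_steinberg, of i j u] assms
  by (simp add: diag_ext_def h_def)

lemma d_h:
  assumes "i \<in> J" "j \<in> J" "i \<noteq> j"
  shows "e i j \<star> h j = e i j"
  using steinberg_cartan[OF e_steinberg, of j u i j] assms bracket_skew[of "e i j" "h j"]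
  by (simp add: h_def)

text \<open>The difference \<open>h i - h j\<close> is a bracket of two elements that kill
  \<open>x\<close>. Thus \<open>h i \<star> x\<close> has no dependence on i, and in a longer word
  the index can be changed to whichever makes the next factor computable.\<close>

lemma hx_eq: assumes "i \<in> J" "j \<in> J" shows "h i \<star> x = h j \<star> x"
proof (cases "i = j")
  case False
  have "(e i j \<star> e j i) \<star> x = 0" using assms False by (simp add: bracket_bracket x_commute)
  then show ?thesis using h_diff[OF assms False] by (simp add: bracket_diff)
qed simp

lemma d_hx: assumes "i \<in> J" "j \<in> J" "k \<in> J" "i \<noteq> j" shows "e i j \<star> h k \<star> x = 0"
  using bracket_leibniz[of "e i j" "h j" x] assms by (simp add: hx_eq[of k j] d_h x_commute)

lemma hhx_eq: assumes "i \<in> J" "j \<in> J" "k \<in> J" "l \<in> J" shows "h i \<star> h k \<star> x = h j \<star> h l \<star> x"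
proof (cases "i = j")
  case False
  have "(e i j \<star> e j i) \<star> h k \<star> x = 0" using assms False by (simp add: bracket_bracket d_hx)
  then show ?thesis using h_diff[OF assms(1,2) False] hx_eq[OF assms(3,4)] by (simp add: bracket_diff)
qed (use hx_eq[OF assms(3,4)] in simp)

lemma d_hhx: assumes "i \<in> J" "j \<in> J" "k \<in> J" "l \<in> J" "i \<noteq> j" shows "e i j \<star> h k \<star> h l \<star> x = 0"
  using bracket_leibniz[of "e i j" "h j" "h l \<star> x"] assms
  by (simp add: hhx_eq[of k j l l] d_h d_hx)

text \<open>Expanding \<open>h i\<close> as a commutator determines the sum of
  \<open>e i u \<star> h i \<star> x\<close> and \<open>h i \<star> e i u \<star> x\<close>; the
  Leibniz rule determines their difference. Adding and halving gives the claim.\<close>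

lemma col_hx: assumes i: "i \<in> J" shows "e i u \<star> h i \<star> x = e i u - e i u \<star> x"
proof -
  let ?b = "e i u" and ?c = "e u i"
  have hy: "h i \<star> y = ?b \<star> ?c \<star> y - ?c \<star> ?b \<star> y" for y by (simp add: h_def bracket_bracket)
  have bb: "?b \<star> ?b \<star> ?c \<star> x = ?b + ?b"
    using i by (simp add: ext_square f_col_row_x scale_two)
  have 1: "?b \<star> h i \<star> x = ?b + ?b - ?b \<star> ?c \<star> ?b \<star> x"
    by (simp add: hy bracket_diff bb)
  have 2: "h i \<star> ?b \<star> x = ?b \<star> ?c \<star> ?b \<star> x"
    using i by (simp add: hy col_col_x)
  have 3: "h i \<star> ?b \<star> x = ?b \<star> x + ?b \<star> x + ?b \<star> h i \<star> x"
    using bracket_leibniz[of "h i" ?b x] by (simp add: h_col[OF i] bracket_linear)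
  have "?b \<star> h i \<star> x + h i \<star> ?b \<star> x = ?b + ?b"
    using 1 by (simp only: 2 eq_diff_eq)
  hence "?b \<star> h i \<star> x + (?b \<star> x + ?b \<star> x + ?b \<star> h i \<star> x) = ?b + ?b"
    by (simp only: 3)
  thus ?thesis by - (rule double_cancel, simp add: algebra_simps)
qed

text \<open>As an operator \<open>h i\<close> is the commutator of \<open>e i u\<close> and
  \<open>e u i\<close>, so the left side is a signed sum of four words. The alternating ones come
  from Premet's identity and contribute \<open>- h i\<close> each, the other two enter with
  \<open>h i + h i\<close> each; \<open>h i + h i\<close> remains.\<close>

lemma hhx:
  assumes i: "i \<in> J"
  shows "h i \<star> h i \<star> x = e i u \<star> e u i \<star> x + e u i \<star> e i u \<star> x + h i + h i"
proof -
  let ?b = "e i u" and ?c = "e u i"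
  have hy: "h i \<star> y = ?b \<star> ?c \<star> y - ?c \<star> ?b \<star> y" for y by (simp add: h_def bracket_bracket)
  have cb: "?c \<star> ?b = - h i" unfolding h_def by (rule bracket_skew)
  have 1: "?b \<star> ?c \<star> ?b \<star> ?c \<star> x = ?b \<star> ?c \<star> x - h i"
    by (rule double_cancel) (use premet(2)[of ?b ?c "?c \<star> x"] i in
      \<open>simp add: row_row_x f_col_row f_col_row_x scale_two h_def algebra_simps\<close>)
  have 2: "?c \<star> ?b \<star> ?c \<star> ?b \<star> x = ?c \<star> ?b \<star> x - h i"
    by (rule double_cancel) (use premet(2)[of ?c ?b "?b \<star> x"] i in
      \<open>simp add: col_col_x f_row_col f_row_col_x scale_two cb algebra_simps\<close>)
  have 3: "?b \<star> ?c \<star> ?c \<star> ?b \<star> x = - (h i + h i)"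
    using i by (simp add: ext_square f_row_col_x bracket_linear scale_two h_def)
  have 4: "?c \<star> ?b \<star> ?b \<star> ?c \<star> x = - (h i + h i)"
    using i by (simp add: ext_square f_col_row_x bracket_linear scale_two cb)
  show ?thesis
    by (simp add: hy[of "h i \<star> x"]) (simp add: hy[of x] bracket_diff 1 2 3 4)
qed

lemma two_col_row_x:
  assumes "i \<in> J"
  shows "e i u \<star> e u i \<star> x + e i u \<star> e u i \<star> x = h i \<star> h i \<star> x + h i \<star> x - (h i + h i)"
  using hhx[OF assms] by (simp add: h_def[of i] bracket_bracket[of _ _ x])

text \<open>Applying \<open>e i j\<close> to the word \<open>e j u \<star> e u j \<star> x\<close>
  replaces only the outer factor, which turns it into the mixed word. The action is computable
  because \<open>two_col_row_x\<close> rewrites the double of that word through \<open>h j\<close>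
  and \<open>x\<close>.\<close>

lemma col_row_x:
  assumes "i \<in> J" "j \<in> J" "i \<noteq> j"
  shows "e i u \<star> e u j \<star> x = - e i j" and "e u j \<star> e i u \<star> x = - e i j"
proof -
  let ?d = "e i j"
  have "?d \<star> e u j = 0" "?d \<star> e j u = e i u"
    using steinberg_commute[OF e_steinberg, of i j u j] steinberg_mult[OF e_steinberg, of i j u] assms
    by simp_all
  hence eq: "?d \<star> e j u \<star> e u j \<star> x = e i u \<star> e u j \<star> x"
    using assms by (simp add: bracket_leibniz[of ?d "e j u"] bracket_leibniz[of ?d "e u j"] x_commute)
  have "?d \<star> (e j u \<star> e u j \<star> x + e j u \<star> e u j \<star> x) = - (?d + ?d)"
    using assms by (simp add: two_col_row_x bracket_linear d_hx d_hhx d_h)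
  hence "e i u \<star> e u j \<star> x + e i u \<star> e u j \<star> x = - (?d + ?d)" by (simp only: bracket_add_right eq)
  thus 1: "e i u \<star> e u j \<star> x = - e i j" by - (rule double_cancel, simp)
  have "(e i u \<star> e u j) \<star> x = 0"
    using steinberg_mult[OF e_steinberg, of i u j] assms by (simp add: x_commute)
  thus "e u j \<star> e i u \<star> x = - e i j" using 1 by (simp add: bracket_bracket)
qed

section \<open>Relations of the matrix units with the new index\<close>

lemma new_col_J: "i \<in> J \<Longrightarrow> new_col i = e i u - e i u \<star> x"
  by (simp add: new_col_def)

lemma new_row_J: "i \<in> J \<Longrightarrow> new_row i = - e u i - e u i \<star> x"
  by (simp add: new_row_def)

lemma transpose_new_col: "extension_step.new_col bracket u r (\<lambda>i j. - e j i) (- x) i = new_row i"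
proof -
  have "- e r u \<star> (- e u r - - e u r \<star> - x) = - ((e u r + e u r \<star> x) \<star> e r u)"
    by (subst bracket_skew) (simp add: bracket_linear algebra_simps)
  thus ?thesis unfolding extension_step.new_col_def[OF transpose] new_row_def by simp
qed

lemma ext_new_col_J: assumes "i \<in> J" shows "ext (new_col i)"
proof -
  have "Exp x (e i u) = new_col i"
    using assms bracket_skew[of x "e i u"] by (simp add: Exp_def f_col new_col_J)
  thus ?thesis using ext_Exp[OF x_ext ext_b[OF assms]] by simp
qed

lemma row_new_col_off: assumes "i \<in> J" "j \<in> J" "i \<noteq> j" shows "e u j \<star> new_col i = 0"
  using steinberg_mult'[OF e_steinberg, of i u j] assms
  by (simp add: new_col_J bracket_diff col_row_x)

lemma d_new_col_J:
  assumes "i \<in> J" "j \<in> J" "k \<in> J" "i \<noteq> j"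
  shows "e i j \<star> new_col k = (if j = k then new_col i else 0)"
proof -
  have "e i j \<star> e k u = (if j = k then e i u else 0)"
    using steinberg_mult[OF e_steinberg, of i j u] steinberg_commute[OF e_steinberg, of i j k u] assms
    by (cases "j = k") simp_all
  thus ?thesis using assms
    by (simp add: new_col_J bracket_diff bracket_leibniz[of "e i j" "e k u" x] x_commute)
qed

text \<open>The reference index \<open>r\<close> may be replaced by any i: expanding
  \<open>e u i\<close> as \<open>e u r \<star> e r i\<close> leaves only the word in which
  \<open>e r i\<close> first turns \<open>new_col i\<close> into \<open>new_col r\<close>.\<close>

lemma new_col_u: assumes "i \<in> J" shows "new_col u = e u i \<star> new_col i"
proof -
  have r: "new_col u = e u r \<star> new_col r" using r_in by (simp add: new_col_def)
  show ?thesis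
  proof (cases "i = r")
    case False
    have "e u i = e u r \<star> e r i" using steinberg_mult[OF e_steinberg, of u r i] assms r_in False by simp
    hence "e u i \<star> new_col i = e u r \<star> e r i \<star> new_col i - e r i \<star> e u r \<star> new_col i"
      by (simp add: bracket_bracket)
    thus ?thesis using r assms r_in False by (simp add: d_new_col_J row_new_col_off)
  qed (simp add: r)
qed

lemma d_new_col_u: assumes "i \<in> J" "j \<in> J" "i \<noteq> j" shows "e i j \<star> new_col u = 0"
proof -
  have "e i j \<star> e u j = 0" using steinberg_commute[OF e_steinberg, of i j u j] assms by simp
  thus ?thesis using assms
    by (simp add: new_col_u[of j] bracket_leibniz[of "e i j" "e u j"] d_new_col_J row_new_col_off)
qed

lemma col_new_col_J: assumes "i \<in> J" "j \<in> J" shows "e i u \<star> new_col j = 0"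
proof -
  have "e i u \<star> e j u = 0"
    using steinberg_commute[OF e_steinberg, of i u j u] assms by (cases "i = j") (simp_all add: bracket_self)
  thus ?thesis using assms by (simp add: new_col_J bracket_diff col_col_x)
qed

lemma col_new_col_u: assumes "i \<in> J" shows "e i u \<star> new_col u = new_col i"
proof -
  have "h i \<star> e i u \<star> x = e i u + e i u \<star> x"
    using bracket_leibniz[of "h i" "e i u" x] assms
    by (simp add: h_col bracket_linear col_hx)
  hence "h i \<star> new_col i = new_col i"
    using assms by (simp add: new_col_J bracket_diff h_col)
  thus ?thesis using assms
    by (simp add: new_col_u[of i] bracket_leibniz[of "e i u" "e u i"] h_def[symmetric] col_new_col_J)
qed

lemma f_row_new_col: "i \<in> J \<Longrightarrow> f (e u i) (new_col i) = 0"
  by (simp add: new_col_J f_diff f_row_col f_row_col_x)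

lemma row_new_col_u: assumes "i \<in> J" shows "e u i \<star> new_col u = 0"
  using assms ext_in[OF ext_new_col_J[OF assms]]
  by (simp add: new_col_u[of i] ext_square f_row_new_col)

text \<open>At \<open>u\<close> the element is a bracket of two extremal elements orthogonal under
  \<open>f\<close>, so \<open>ext_bracket\<close> applies.\<close>

lemma ext_new_col: assumes "i \<in> insert u J" shows "ext (new_col i)"
proof (cases "i = u")
  case True
  then show ?thesis
    using ext_bracket[OF ext_c[OF r_in] ext_new_col_J[OF r_in] f_row_new_col[OF r_in]]
    by (simp add: new_col_u[OF r_in])
qed (use assms ext_new_col_J in simp)

text \<open>Inside \<open>J\<close> the only delicate term is quadratic in \<open>x\<close>, and
  Premet's identity annihilates it since every \<open>f\<close>-value in it is zero. With
  \<open>u\<close>, the bracket is minus the square of ad \<open>new_col i\<close> applied to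
  \<open>e u i\<close>, a multiple of \<open>f (e u i) (new_col i) = 0\<close>.\<close>

lemma new_col_new_col:
  assumes "i \<in> insert u J" "j \<in> insert u J"
  shows "new_col i \<star> new_col j = 0"
proof -
  have JJ: "new_col i \<star> new_col j = 0" if "i \<in> J" "j \<in> J" for i j
  proof -
    let ?a = "e i u" and ?b = "e j u"
    have ab: "?a \<star> ?b = 0"
      using steinberg_commute[OF e_steinberg, of i u j u] that by (cases "i = j") (simp_all add: bracket_self)
    have xx: "(x \<star> ?a) \<star> (x \<star> ?b) = 0"
      by (rule double_cancel) (use premet(1)[OF x_ext, of ?a ?b] that ab in \<open>simp add: f_col\<close>)
    have s: "?a \<star> x = - (x \<star> ?a)" "?b \<star> x = - (x \<star> ?b)" by (rule bracket_skew)+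
    have "?a \<star> x \<star> ?b = 0" using col_col_x[OF that] s by simp
    moreover have "(x \<star> ?a) \<star> ?b = 0"
      using col_col_x[OF that(2,1)] s bracket_skew[of "x \<star> ?a" ?b] by simp
    ultimately show ?thesis
      using that by (simp add: new_col_J bracket_linear ab s xx)
  qed
  have Ju: "new_col i \<star> new_col u = 0" if "i \<in> J" for i
  proof -
    have "new_col i \<star> new_col u = - (new_col i \<star> new_col i \<star> e u i)"
      using that by (simp add: new_col_u[of i] bracket_skew[of "e u i" "new_col i"])
    also have "\<dots> = 0"
      using that ext_new_col_J[OF that] f_row_new_col[OF that] f_sym[of "e u i" "new_col i"]
      by (simp add: ext_square)
    finally show ?thesis .
  qed
  have "new_col u \<star> new_col i = 0" if "i \<in> J" for i
    using Ju[OF that] bracket_skew[of "new_col u" "new_col i"] by simp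
  thus ?thesis
    using assms JJ Ju by (auto simp: bracket_self)
qed

lemma e_new_col:
  assumes "i \<in> insert u J" "j \<in> insert u J" "k \<in> insert u J" "i \<noteq> j"
  shows "e i j \<star> new_col k = (if j = k then new_col i else 0)"
  using assms
  by (auto simp: d_new_col_J d_new_col_u col_new_col_J col_new_col_u row_new_col_off row_new_col_u
      new_col_u[symmetric])

lemma new_row_new_row:
  assumes "i \<in> insert u J" "j \<in> insert u J"
  shows "new_row i \<star> new_row j = 0"
  using extension_step.new_col_new_col[OF transpose assms] by (simp only: transpose_new_col)

lemma ext_new_row: "i \<in> insert u J \<Longrightarrow> ext (new_row i)"
  using extension_step.ext_new_col[OF transpose] by (simp only: transpose_new_col)

lemma e_new_row:
  assumes "i \<in> insert u J" "j \<in> insert u J" "k \<in> insert u J" "i \<noteq> j"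
  shows "e j i \<star> new_row k = - (if j = k then new_row i else 0)"
proof -
  have "- (e j i \<star> new_row k) = (if j = k then new_row i else 0)"
    using extension_step.e_new_col[OF transpose assms] by (simp only: transpose_new_col bracket_minus)
  thus ?thesis by (simp only: minus_equation_iff[of "e j i \<star> new_row k"])
qed

lemma new_col_new_row_J:
  assumes "i \<in> J" "j \<in> J"
  shows "new_col i \<star> new_row j = - (e i u \<star> e u j) - e i u \<star> e u j \<star> x - e u j \<star> e i u \<star> x
    + (x \<star> e i u) \<star> (x \<star> e u j)"
proof -
  have s: "e i u \<star> x = - (x \<star> e i u)" "e u j \<star> x = - (x \<star> e u j)" by (rule bracket_skew)+
  have "(x \<star> e i u) \<star> e u j = - (e u j \<star> x \<star> e i u)" by (rule bracket_skew)
  thus ?thesis using assms by (simp add: new_col_J new_row_J bracket_linear s algebra_simps)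
qed

lemma new_col_new_row_off:
  assumes "i \<in> J" "j \<in> J" "i \<noteq> j"
  shows "new_col i \<star> new_row j = e i j"
proof -
  have m: "e i u \<star> e u j = e i j" using steinberg_mult[OF e_steinberg, of i u j] assms by simp
  have "f x (e i j) = 0"
  proof (cases "x = 0")
    case False
    have "x \<star> e i j = 0" using x_commute assms bracket_skew[of x "e i j"] by simp
    thus ?thesis using False x_ext assms by (intro f_eqI) auto
  qed (use assms in simp)
  hence "(x \<star> e i u) \<star> (x \<star> e u j) = 0"
    using premet(1)[OF x_ext, of "e i u" "e u j"] assms m
    by - (rule double_cancel, simp add: f_col f_row)
  thus ?thesis using assms by (simp add: new_col_new_row_J col_row_x m)
qed

text \<open>Here the normalization in \<open>f_cartan\<close> is decisive: with the value 2,
  Premet's identity makes the term quadratic in \<open>x\<close> equal to \<open>x\<close> itself,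
  with coefficient 1.\<close>

lemma new_col_new_row_same:
  assumes "i \<in> J"
  shows "new_col i \<star> new_row i = h i - h i \<star> h i \<star> x + x"
proof -
  have "(x \<star> e i u) \<star> (x \<star> e u i) = x"
    using premet(1)[OF x_ext, of "e i u" "e u i"] assms f_cartan[OF assms]
    by - (rule double_cancel, simp add: f_col f_row scale_two)
  thus ?thesis using assms by (simp add: new_col_new_row_J hhx h_def[symmetric] algebra_simps)
qed

text \<open>In the model both sides are E_mu - E_um. This identity turns the diagonal relation into
  an expression of \<open>x\<close> by the new units.\<close>

lemma hhx_new:
  assumes "i \<in> J"
  shows "h i \<star> h i \<star> x = new_row u - new_col u"
proof -
  have "new_col u = - h i - e u i \<star> e i u \<star> x"
    using bracket_skew[of "e u i" "e i u"] assms
    by (simp add: new_col_u[of i] new_col_J bracket_diff h_def)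
  moreover have "new_row u = new_row i \<star> e i u"
    using e_new_row[of u i i] assms bracket_skew[of "new_row i" "e i u"] by simp
  hence "new_row u = h i + e i u \<star> e u i \<star> x"
    using assms bracket_skew[of "e u i" "e i u"] bracket_skew[of "e u i \<star> x" "e i u"]
    by (simp add: new_row_J bracket_linear h_def)
  ultimately show ?thesis using hhx[OF assms] by (simp add: algebra_simps)
qed

lemma new_col_new_row_u:
  assumes "i \<in> J"
  shows "new_col i \<star> new_row u = e i u"
proof -
  have u: "new_row u = new_row i \<star> e i u"
    using e_new_row[of u i i] assms bracket_skew[of "new_row i" "e i u"] by simp
  have bu: "e i u \<star> new_row u = 0" using e_new_row[of u i u] assms by simp
  have "new_col i \<star> new_row u = (new_col i \<star> new_row i) \<star> e i u + new_row i \<star> new_col i \<star> e i u"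
    unfolding u by (rule bracket_leibniz)
  also have "new_col i \<star> e i u = 0"
    using col_new_col_J[OF assms assms] bracket_skew[of "new_col i" "e i u"] by simp
  also have "new_col i \<star> new_row i = h i - (new_row u - new_col u) + x"
    using assms by (simp add: new_col_new_row_same hhx_new)
  also have "\<dots> \<star> e i u = h i \<star> e i u - e i u \<star> x - e i u \<star> new_col u"
    using bu bracket_skew[of "new_row u" "e i u"] bracket_skew[of "new_col u" "e i u"]
      bracket_skew[of x "e i u"] by (simp add: bracket_linear)
  finally show ?thesis using assms by (simp add: h_col col_new_col_u new_col_J)
qed

lemma new_row_new_col_u:
  assumes "i \<in> J"
  shows "new_col u \<star> new_row i = e u i"
proof -
  have row: "extension_step.new_row bracket u r (\<lambda>i j. - e j i) (- x) i = new_col i" for i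
  proof -
    have "- ((- e r u + - e r u \<star> - x) \<star> - e u r) = e u r \<star> (e r u - e r u \<star> x)"
      using bracket_skew[of "e r u" "e u r"] bracket_skew[of "e r u \<star> x" "e u r"]
      by (simp add: bracket_linear)
    thus ?thesis unfolding extension_step.new_row_def[OF transpose] new_col_def by simp
  qed
  show ?thesis
    using extension_step.new_col_new_row_u[OF transpose assms]
      bracket_skew[of "new_col u" "new_row i"]
    by (simp add: transpose_new_col row)
qed

lemma new_col_new_row:
  assumes "i \<in> insert u J" "j \<in> insert u J" "i \<noteq> j"
  shows "new_col i \<star> new_row j = e i j"
  using assms by (auto simp: new_col_new_row_off new_col_new_row_u new_row_new_col_u)

definition extended :: "'i \<Rightarrow> 'i \<Rightarrow> 'i \<Rightarrow> 'v" where
  "extended m i j = (if j = m then new_col i else if i = m then new_row j else e i j)"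

context
  fixes m
  assumes m: "m \<notin> insert u J"
begin

text \<open>The indices \<open>r\<close>, \<open>u\<close> and \<open>m\<close> are distinct even if
  the old system had only two, so \<open>steinbergI\<close> applies and leaves just products and
  vanishing brackets to check.\<close>

lemma steinberg_extended: "steinberg (insert m (insert u J)) (extended m)"
proof (rule steinbergI)
  have col_e: "new_col k \<star> e i j = - (if j = k then new_col i else 0)"
    if "i \<in> insert u J" "j \<in> insert u J" "k \<in> insert u J" "i \<noteq> j" for i j k
    using e_new_col[OF that] bracket_skew[of "new_col k" "e i j"] by simp
  have row_e: "new_row k \<star> e j i = (if j = k then new_row i else 0)"
    if "i \<in> insert u J" "j \<in> insert u J" "k \<in> insert u J" "i \<noteq> j" for i j k
    using e_new_row[OF that] bracket_skew[of "new_row k" "e j i"] by simp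
  let ?K = "insert u J"
  have Km: "\<And>i. i \<in> ?K \<Longrightarrow> i \<noteq> m" using m by auto
  fix i j k l
  {
    assume "i \<in> insert m ?K" "j \<in> insert m ?K" "k \<in> insert m ?K" and ne: "i \<noteq> j" "j \<noteq> k" "i \<noteq> k"
    then consider "k = m" "i \<in> ?K" "j \<in> ?K" | "i = m" "k \<in> ?K" "j \<in> ?K" | "j = m" "k \<in> ?K" "i \<in> ?K"
      | "i \<in> ?K" "j \<in> ?K" "k \<in> ?K" by blast
    then show "extended m i j \<star> extended m j k = extended m i k"
      by cases (use ne Km in \<open>simp_all add: extended_def e_new_col[of i j j] row_e[of k j j]
          new_col_new_row steinberg_mult[OF e_steinberg] del: insert_iff\<close>)
  }
  {
    assume mem: "i \<in> insert m ?K" "j \<in> insert m ?K" "k \<in> insert m ?K" "l \<in> insert m ?K"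
      and ne: "i \<noteq> j" "k \<noteq> l" "j \<noteq> k" "i \<noteq> l"
    have K: "i \<noteq> m \<Longrightarrow> i \<in> ?K" "j \<noteq> m \<Longrightarrow> j \<in> ?K" "k \<noteq> m \<Longrightarrow> k \<in> ?K" "l \<noteq> m \<Longrightarrow> l \<in> ?K"
      using mem by blast+
    consider "l = m" "j = m" | "l = m" "j \<noteq> m" | "l \<noteq> m" "i = m" "k = m" | "l \<noteq> m" "i = m" "k \<noteq> m"
      | "l \<noteq> m" "i \<noteq> m" "j = m" | "l \<noteq> m" "i \<noteq> m" "j \<noteq> m" "k = m"
      | "l \<noteq> m" "i \<noteq> m" "j \<noteq> m" "k \<noteq> m" by argo
    then show "extended m i j \<star> extended m k l = 0"
    proof cases
      case 1
      then show ?thesis using new_col_new_col[OF K(1,3)] ne by (simp add: extended_def)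
    next
      case 2
      then show ?thesis using e_new_col[OF K(1,2,3)] ne by (simp add: extended_def)
    next
      case 3
      then show ?thesis using new_row_new_row[OF K(2,4)] ne by (simp add: extended_def)
    next
      case 4
      then show ?thesis using row_e[OF K(4,3,2)] ne by (simp add: extended_def)
    next
      case 5
      then show ?thesis using col_e[OF K(3,4,1)] ne by (simp add: extended_def)
    next
      case 6
      then show ?thesis using e_new_row[OF K(2,1,4)] ne by (simp add: extended_def)
    next
      case 7
      then show ?thesis using steinberg_commute[OF e_steinberg K] ne by (simp add: extended_def)
    qed
  }
  have "u \<in> insert m ?K" "m \<in> insert m ?K" "r \<in> insert m ?K" "u \<noteq> m" "r \<noteq> u" "r \<noteq> m"
    using r_in u_notin m by auto
  thus "\<exists>k\<in>insert m ?K. k \<noteq> i \<and> k \<noteq> j"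
    by (cases "u \<noteq> i \<and> u \<noteq> j"; cases "m \<noteq> i \<and> m \<noteq> j") (blast, blast, blast, blast)
qed

lemma ext_extended:
  "i \<in> insert m (insert u J) \<Longrightarrow> j \<in> insert m (insert u J) \<Longrightarrow> i \<noteq> j \<Longrightarrow> ext (extended m i j)"
  using ext_new_col ext_new_row e_ext by (auto simp: extended_def)

lemma offdiag_extended:
  "lie_generated smul bracket (offdiag (extended m) (insert m (insert u J))) =
    lie_generated smul bracket (insert x (offdiag e (insert u J)))"
proof (rule lie_generated_eqI)
  let ?K = "insert u J"
  let ?A = "lie_generated smul bracket (insert x (offdiag e ?K))"
  let ?B = "lie_generated smul bracket (offdiag (extended m) (insert m ?K))"
  note A = lie_subalgebraD[OF lie_generated_subalgebra[of "insert x (offdiag e ?K)"]]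
  note B = lie_subalgebraD[OF lie_generated_subalgebra[of "offdiag (extended m) (insert m ?K)"]]
  have xA: "x \<in> ?A" by (rule subsetD[OF lie_generated_superset]) simp
  have eA: "e i j \<in> ?A" if "i \<in> ?K" "j \<in> ?K" "i \<noteq> j" for i j
    by (rule subsetD[OF lie_generated_superset]) (use that in \<open>auto simp: offdiag_def\<close>)
  have ru: "r \<in> ?K" "u \<in> ?K" "r \<noteq> u" "u \<noteq> r" using r_in by auto
  have er: "e r u \<in> ?A" "e u r \<in> ?A" using eA ru by blast+
  have colA: "new_col i \<in> ?A" and rowA: "new_row i \<in> ?A" if i: "i \<in> ?K" for i
  proof -
    have "new_col i \<in> ?A \<and> new_row i \<in> ?A"
    proof (cases "i = u")
      case True
      show ?thesis
        unfolding new_col_def new_row_def if_P[OF True] by (intro conjI A(2) A(4) A(5) A(6) er xA)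
    next
      case False
      have ei: "e i u \<in> ?A" "e u i \<in> ?A" using eA i ru(2) False by blast+
      show ?thesis
        unfolding new_col_def new_row_def if_not_P[OF False] by (intro conjI A(2) A(4) A(5) A(6) ei xA)
    qed
    thus "new_col i \<in> ?A" "new_row i \<in> ?A" by simp_all
  qed
  show "offdiag (extended m) (insert m ?K) \<subseteq> ?A"
  proof
    fix y assume "y \<in> offdiag (extended m) (insert m ?K)"
    then obtain i j where y: "y = extended m i j" and ij: "i \<in> insert m ?K" "j \<in> insert m ?K" "i \<noteq> j"
      unfolding offdiag_def by blast
    show "y \<in> ?A"
    proof (cases "j = m")
      case True
      then show ?thesis using colA[of i] ij y by (simp add: extended_def)
    next
      case j: False
      then show ?thesis using rowA[of j] eA[of i j] ij y by (cases "i = m") (simp_all add: extended_def)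
    qed
  qed
  have EB: "extended m i j \<in> ?B" if "i \<in> insert m ?K" "j \<in> insert m ?K" "i \<noteq> j" for i j
    by (rule subsetD[OF lie_generated_superset]) (use that in \<open>auto simp: offdiag_def\<close>)
  have Km: "\<And>i. i \<in> ?K \<Longrightarrow> i \<noteq> m" using m by blast
  have eB: "e i j \<in> ?B" if "i \<in> ?K" "j \<in> ?K" "i \<noteq> j" for i j
    using EB[of i j] that Km[OF that(1)] Km[OF that(2)] by (simp add: extended_def)
  have colB: "new_col i \<in> ?B" if "i \<in> ?K" for i
    using EB[of i m] that Km[OF that] by (simp add: extended_def)
  have rowB: "new_row i \<in> ?B" if "i \<in> ?K" for i
    using EB[of m i] that Km[OF that] by (simp add: extended_def)
  \<comment> \<open>In the model this reads (E_rr - E_mm) - (E_rr - E_uu) + (E_mu - E_um).\<close>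
  have "x = new_col r \<star> new_row r - h r + (new_row u - new_col u)"
    using new_col_new_row_same[OF r_in] hhx_new[OF r_in] by simp
  also have "\<dots> \<in> ?B"
    unfolding h_def using ru by (intro B(2) B(6) B(4) colB rowB eB)
  finally have "x \<in> ?B" .
  moreover have "offdiag e ?K \<subseteq> ?B" using eB unfolding offdiag_def by blast
  ultimately show "insert x (offdiag e ?K) \<subseteq> ?B" by blast
qed

end

end

section \<open>Induction along the graph\<close>

context extremal_algebra
begin

section \<open>Change of generating pairs and the choice of adapted root vectors\<close>

lemma Exp_generated:
  assumes S: "lie_subalgebra smul bracket S" and "b \<in> S" "a \<in> S"
  shows "Exp b a \<in> S"
  unfolding Exp_def using assms by (intro lie_subalgebraD[OF S])

text \<open>The opposite exponential undoes the move inside the new subalgebra, so a generating pair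
  can be adjusted without losing anything.\<close>

lemma lie_generated_Exp:
  assumes b: "ext b" and a: "a \<in> L"
  shows "lie_generated smul bracket {Exp (c \<odot> b) a, b} = lie_generated smul bracket {a, b}"
proof (rule lie_generated_eqI)
  note S = lie_generated_subalgebra
  have g: "{v, w} \<subseteq> lie_generated smul bracket {v, w}" for v w by (rule lie_generated_superset)
  have "Exp (c \<odot> b) a \<in> lie_generated smul bracket {a, b}"
    using g[of a b] lie_subalgebraD(3)[OF S] by (intro Exp_generated[OF S]) auto
  thus "{Exp (c \<odot> b) a, b} \<subseteq> lie_generated smul bracket {a, b}" using g[of a b] by auto
  let ?a = "Exp (c \<odot> b) a"
  have "Exp (- (c \<odot> b)) ?a = a"
    using Exp_minus[OF ext_minus[OF ext_scale[OF b]], of a c] a by simp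
  moreover have "Exp (- (c \<odot> b)) ?a \<in> lie_generated smul bracket {?a, b}"
    using g[of ?a b] lie_subalgebraD(3,5)[OF S] by (auto intro!: Exp_generated[OF S, where a = ?a])
  ultimately show "{a, b} \<subseteq> lie_generated smul bracket {?a, b}" using g[of ?a b] by auto
qed

lemma lie_generated_scale:
  assumes "c \<noteq> 0"
  shows "lie_generated smul bracket (insert (c \<odot> a) A) = lie_generated smul bracket (insert a A)"
proof -
  have 1: "lie_generated smul bracket (insert (c \<odot> a) A) \<subseteq> lie_generated smul bracket (insert a A)" for c a
  proof (rule lie_generated_least[OF lie_generated_subalgebra])
    have "insert a A \<subseteq> lie_generated smul bracket (insert a A)" by (rule lie_generated_superset)
    thus "insert (c \<odot> a) A \<subseteq> lie_generated smul bracket (insert a A)"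
      using lie_subalgebraD(3)[OF lie_generated_subalgebra] by auto
  qed
  have "a = inverse c \<odot> (c \<odot> a)" using assms by simp
  hence "lie_generated smul bracket (insert a A) \<subseteq> lie_generated smul bracket (insert (c \<odot> a) A)"
    using 1[of "inverse c" "c \<odot> a"] by metis
  thus ?thesis using 1 by blast
qed

lemma Exp_scale_left:
  assumes "b \<in> L" "a \<in> L"
  shows "Exp (c \<odot> b) a = a + c \<odot> (b \<star> a) + (c\<^sup>2 * f b a / 2) \<odot> b"
  using assms by (simp add: Exp_def bracket_linear f_linear power2_eq_square)

text \<open>The discriminant condition says that the linear form \<open>f y\<close> on the copy of \<open>sl\<^sub>2\<close> spanned by
  \<open>a\<close>, \<open>b\<close> and their bracket is dual to a semisimple element; \<open>a'\<close> and \<open>b'\<close> are root vectors for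
  the torus through that element.\<close>

lemma adapted_pair:
  assumes closed: "\<And>\<alpha> \<beta> \<gamma> :: 'k. \<alpha> \<noteq> 0 \<or> \<beta> \<noteq> 0 \<Longrightarrow> \<exists>z. \<alpha> * z\<^sup>2 + \<beta> * z + \<gamma> = 0"
    and a: "ext a" and b: "ext b" and y: "y \<in> L"
    and r0: "f a b \<noteq> 0" and disc: "(f y (a \<star> b))\<^sup>2 \<noteq> 2 * f a b * f y a * f y b"
  obtains a' b' where "ext a'" "ext b'" "(a' \<star> b') \<star> a' = a' + a'" "(b' \<star> a') \<star> b' = b' + b'"
    "f y a' = 0" "f y b' = 0" "f y (a' \<star> b') \<noteq> 0"
    "lie_generated smul bracket {a', b'} = lie_generated smul bracket {a, b}"
proof -
  define r p q s where "r = f a b" and "p = f y a" and "q = f y b" and "s = f y (a \<star> b)"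
  have ab: "a \<in> L" "b \<in> L" using a b by auto
  have r: "f b a = r" using f_sym[of a b] ab by (simp add: r_def)
  have rn: "r \<noteq> 0" using r0 by (simp add: r_def)
  \<comment> \<open>The quadratic in z to be solved expresses
    \<open>f y (Exp (z \<odot> b) a) = 0\<close>. If both leading coefficients were zero, so would
    be q and s, and the two sides of \<open>disc\<close> would coincide.\<close>
  have "r * q / 2 \<noteq> 0 \<or> - s \<noteq> 0"
    using disc rn by (auto simp: r_def q_def s_def)
  then obtain z where z: "r * q / 2 * z\<^sup>2 + - s * z + p = 0" using closed by blast
  define t where "t = z\<^sup>2 * r / 2"
  have tt: "2 * t = z\<^sup>2 * r" by (simp add: t_def)
  have z': "p = s * z - t * q" using z by (simp add: t_def algebra_simps)
  define a1 where "a1 = Exp (z \<odot> b) a"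
  have ea1: "ext a1" unfolding a1_def using a b by (intro ext_Exp ext_scale)
  have a1: "a1 = a + z \<odot> (b \<star> a) + t \<odot> b"
    unfolding a1_def using ab by (simp add: Exp_scale_left t_def r)
  have a1L: "a1 \<in> L" using ea1 by auto
  have ba: "b \<star> a = - (a \<star> b)" by (rule bracket_skew)
  have ya1: "f y a1 = 0"
    using ab y by (simp add: a1 f_linear ba p_def[symmetric] q_def[symmetric] s_def[symmetric] z')
  have "Exp (z \<odot> b) b = b" using b ab by (simp add: Exp_scale_left bracket_self)
  hence fa1: "f a1 b = r"
    using f_Exp[OF ext_scale[OF b], of a b z] ab by (simp add: a1_def r_def)
  have "(a \<star> b) \<star> b = r \<odot> b"
    using ext_square[OF b ab(1)] r bracket_skew[of "a \<star> b" b] ba by simp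
  hence a1b: "a1 \<star> b = a \<star> b - (z * r) \<odot> b"
    by (simp add: a1 bracket_linear ba)
  define s1 where "s1 = f y (a1 \<star> b)"
  have s1: "s1 = s - z * r * q" using ab y by (simp add: s1_def a1b f_linear s_def q_def)
  \<comment> \<open>Replacing \<open>a\<close> by \<open>a1\<close> preserves the discriminant,
    which for \<open>a1\<close> is just the square of \<open>s1\<close> because
    \<open>f y a1 = 0\<close>.\<close>
  have "s1\<^sup>2 = s\<^sup>2 - 2 * r * q * (s * z) + (z\<^sup>2 * r) * r * q\<^sup>2"
    by (simp add: s1 power2_eq_square algebra_simps)
  also have "\<dots> = s\<^sup>2 - 2 * r * q * (s * z) + 2 * t * r * q\<^sup>2" by (simp only: tt)
  also have "\<dots> = s\<^sup>2 - 2 * r * p * q" by (simp add: z' power2_eq_square algebra_simps)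
  also have "\<dots> \<noteq> 0" using disc by (simp add: r_def p_def q_def s_def)
  finally have s1n: "s1 \<noteq> 0" by auto
  \<comment> \<open>Since \<open>f y a1 = 0\<close>, the quadratic term disappears and
    \<open>f y (Exp (w \<odot> a1) b)\<close> is q + w s1; this w is its zero.\<close>
  define w where "w = - q / s1"
  define b1 where "b1 = Exp (w \<odot> a1) b"
  have eb1: "ext b1" unfolding b1_def using b ea1 by (intro ext_Exp ext_scale)
  have b1: "b1 = b + w \<odot> (a1 \<star> b) + (w\<^sup>2 * r / 2) \<odot> a1"
    unfolding b1_def using ab a1L by (simp add: Exp_scale_left fa1)
  have b1L: "b1 \<in> L" using eb1 by auto
  have yb1: "f y b1 = 0"
    using ab a1L y s1n by (simp add: b1 f_linear ya1 q_def[symmetric] s1_def[symmetric] w_def)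
  have "Exp (w \<odot> a1) a1 = a1" using ea1 a1L by (simp add: Exp_scale_left bracket_self)
  hence fb1: "f a1 b1 = r"
    using f_Exp[OF ext_scale[OF ea1], of a1 b w] ab a1L fa1 by (simp add: b1_def)
  have fb1': "f b1 a1 = r" using fb1 f_sym[of a1 b1] a1L b1L by simp
  have "a1 \<star> b1 = a1 \<star> b + (w * r) \<odot> a1"
    using ab ea1 by (simp add: b1 bracket_linear ext_square fa1)
  hence ys: "f y (a1 \<star> b1) = s1" using ab a1L y by (simp add: f_linear ya1 s1_def)
  \<comment> \<open>As \<open>f a1 b1 = r\<close>, this factor brings the pair to the value -2 of
    opposite matrix units.\<close>
  define b2 where "b2 = (- 2 / r) \<odot> b1"
  have eb2: "ext b2" unfolding b2_def by (rule ext_scale[OF eb1])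
  have "f a1 b2 = - 2" "f b2 a1 = - 2"
    using a1L b1L rn by (simp_all add: b2_def f_linear fb1 fb1')
  hence "a1 \<star> a1 \<star> b2 = - (a1 + a1)" "b2 \<star> b2 \<star> a1 = - (b2 + b2)"
    using ext_square[OF ea1, of b2] ext_square[OF eb2, of a1] eb2 a1L by (simp_all add: scale_two ext_in)
  hence "(a1 \<star> b2) \<star> a1 = a1 + a1" "(b2 \<star> a1) \<star> b2 = b2 + b2"
    using bracket_skew[of "a1 \<star> b2" a1] bracket_skew[of "b2 \<star> a1" b2] by simp_all
  moreover have "f y b2 = 0" "f y (a1 \<star> b2) \<noteq> 0"
    using a1L b1L y rn s1n by (simp_all add: b2_def f_linear bracket_linear yb1 ys)
  moreover have "lie_generated smul bracket {a1, b2} = lie_generated smul bracket {a, b}"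
  proof -
    have "lie_generated smul bracket {a1, b2} = lie_generated smul bracket {b2, a1}"
      by (simp add: insert_commute)
    also have "\<dots> = lie_generated smul bracket {b1, a1}"
      unfolding b2_def using rn by (intro lie_generated_scale) simp
    also have "\<dots> = lie_generated smul bracket {b, a1}"
      unfolding b1_def by (rule lie_generated_Exp[OF ea1 ab(2)])
    also have "\<dots> = lie_generated smul bracket {a1, b}" by (simp add: insert_commute)
    also have "\<dots> = lie_generated smul bracket {a, b}"
      unfolding a1_def by (rule lie_generated_Exp[OF b ab(1)])
    finally show ?thesis .
  qed
  ultimately show ?thesis using that ea1 eb2 ya1 by blast
qed

lemma steinberg_pair:
  assumes "(a \<star> b) \<star> a = a + a" "(b \<star> a) \<star> b = b + b"
  shows "steinberg {..<2} (\<lambda>(i :: nat) (j :: nat). if i = 0 then a else b)"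
proof -
  have two: "i \<in> {..<2} \<longleftrightarrow> i = 0 \<or> i = 1" for i :: nat by auto
  show ?thesis
    unfolding steinberg_def using assms by (auto simp: two bracket_self)
qed

lemma f_eq_0_centralizer:
  assumes "ext x" "c \<in> L" "x \<star> c = 0"
  shows "f x c = 0"
proof (cases "x = 0")
  case False
  thus ?thesis using assms by (intro f_eqI) auto
qed (use assms in simp)

text \<open>The two Cartan elements differ by \<open>e i j \<star> e j i\<close>, which is
  orthogonal to \<open>x\<close> by invariance because \<open>x\<close> commutes with
  \<open>e i j\<close>. So a single scalar normalizes all values at once.\<close>

lemma f_cartan_eq:
  fixes m :: nat
  assumes st: "steinberg {..<Suc m} e" and ext: "\<And>i j. i < Suc m \<Longrightarrow> j < Suc m \<Longrightarrow> i \<noteq> j \<Longrightarrow> ext (e i j)"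
    and x: "ext x" and xc: "\<And>i j. i < m \<Longrightarrow> j < m \<Longrightarrow> i \<noteq> j \<Longrightarrow> e i j \<star> x = 0"
    and ij: "i < m" "j < m"
  shows "f x (e i m \<star> e m i) = f x (e j m \<star> e m j)"
proof (cases "i = j")
  case False
  have L: "e i j \<in> L" "e j i \<in> L" "e i m \<in> L" "e m i \<in> L" "e j m \<in> L" "e m j \<in> L"
    using ext ij False by auto
  have "x \<star> e i j = 0" using xc[of i j] ij False bracket_skew[of x "e i j"] by simp
  hence "f x (e i j \<star> e j i) = 0"
    using L x by (intro f_centralizer) auto
  moreover have "e i j \<star> e j i = e i m \<star> e m i - e j m \<star> e m j"
    using steinberg_opposite[OF st, of i j m] ij False by (simp add: diag_ext_def)
  ultimately show ?thesis using L x by (simp add: f_diff ext_in)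
qed simp

text \<open>A multiple of \<open>x\<close> meets the normalization of \<open>extension_step\<close>,
  with \<open>m\<close> as \<open>u\<close>, 0 as \<open>r\<close> and \<open>Suc m\<close> as the
  new index. The last conclusion keeps the old block, because the following generator has to commute
  with exactly that block.\<close>

lemma extend_system:
  fixes m :: nat
  assumes m: "m \<ge> 1" and st: "steinberg {..<Suc m} e"
    and ext: "\<And>i j. i < Suc m \<Longrightarrow> j < Suc m \<Longrightarrow> i \<noteq> j \<Longrightarrow> ext (e i j)"
    and x: "ext x" and xc: "\<And>i j. i < m \<Longrightarrow> j < m \<Longrightarrow> i \<noteq> j \<Longrightarrow> e i j \<star> x = 0"
    and fc: "\<And>i. i < m \<Longrightarrow> f x (e i m) = 0" and fr: "\<And>i. i < m \<Longrightarrow> f x (e m i) = 0"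
    and fh: "f x (e 0 m \<star> e m 0) \<noteq> 0"
  shows "\<exists>e'. steinberg {..<Suc (Suc m)} e' \<and>
    (\<forall>i<Suc (Suc m). \<forall>j<Suc (Suc m). i \<noteq> j \<longrightarrow> ext (e' i j)) \<and>
    lie_generated smul bracket (offdiag e' {..<Suc (Suc m)}) =
      lie_generated smul bracket (insert x (offdiag e {..<Suc m})) \<and>
    offdiag e' {..<Suc m} = offdiag e {..<Suc m}"
proof -
  define c where "c = 2 / f x (e 0 m \<star> e m 0)"
  have c0: "c \<noteq> 0" using fh by (simp add: c_def)
  have K: "{..<Suc m} = insert m {..<m}" "{..<Suc (Suc m)} = insert (Suc m) (insert m {..<m})"
    by auto
  have L: "e i j \<in> L" if "i < Suc m" "j < Suc m" "i \<noteq> j" for i j using ext[OF that] by auto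
  interpret extension_step smul bracket L f "{..<m}" m 0 e "c \<odot> x"
  proof
    show "0 \<in> {..<m}" "m \<notin> {..<m}" using m by auto
    show "steinberg (insert m {..<m}) e" using st by (simp add: K)
    show "ext (e i j)" if "i \<in> insert m {..<m}" "j \<in> insert m {..<m}" "i \<noteq> j" for i j
      using that by (intro ext) auto
    show "ext (c \<odot> x)" by (rule ext_scale[OF x])
    show "e i j \<star> c \<odot> x = 0" if "i \<in> {..<m}" "j \<in> {..<m}" "i \<noteq> j" for i j
      using xc that by (simp add: bracket_linear)
    fix i assume i: "i \<in> {..<m}"
    hence Li: "e i m \<in> L" "e m i \<in> L" using L by auto
    show "f (c \<odot> x) (e i m) = 0" "f (c \<odot> x) (e m i) = 0"
      using i x Li fc fr by (simp_all add: f_linear ext_in)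
    have "f x (e i m \<star> e m i) = f x (e 0 m \<star> e m 0)"
      using i m by (intro f_cartan_eq[OF st ext x xc]) auto
    thus "f (c \<odot> x) (e i m \<star> e m i) = 2"
      using x Li fh by (simp add: f_linear ext_in c_def)
  qed
  have m': "Suc m \<notin> insert m {..<m}" by auto
  show ?thesis
  proof (intro exI[of _ "extended (Suc m)"] conjI allI impI)
    show "steinberg {..<Suc (Suc m)} (extended (Suc m))"
      unfolding K(2) by (rule steinberg_extended[OF m'])
    show "ext (extended (Suc m) i j)" if "i < Suc (Suc m)" "j < Suc (Suc m)" "i \<noteq> j" for i j
      by (rule ext_extended[OF m']) (use that in auto)
    show "lie_generated smul bracket (offdiag (extended (Suc m)) {..<Suc (Suc m)}) =
      lie_generated smul bracket (insert x (offdiag e {..<Suc m}))"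
      using offdiag_extended[OF m'] lie_generated_scale[OF c0, of x] by (simp only: K)
    have "extended (Suc m) i j = e i j" if "i < Suc m" "j < Suc m" for i j
      using that by (simp add: extended_def)
    thus "offdiag (extended (Suc m)) {..<Suc m} = offdiag e {..<Suc m}"
      unfolding offdiag_def by (metis lessThan_iff)
  qed
qed

text \<open>Once \<open>f x\<close> vanishes on one Cartan element it vanishes on all, hence on a
  spanning set of the generated subalgebra. It serves to show that a generator not orthogonal to its
  predecessor has a nonzero Cartan value.\<close>

lemma f_eq_0_generated:
  fixes m :: nat
  assumes m: "m \<ge> 1" and st: "steinberg {..<Suc m} e"
    and ext: "\<And>i j. i < Suc m \<Longrightarrow> j < Suc m \<Longrightarrow> i \<noteq> j \<Longrightarrow> ext (e i j)"
    and x: "ext x" and xc: "\<And>i j. i < m \<Longrightarrow> j < m \<Longrightarrow> i \<noteq> j \<Longrightarrow> e i j \<star> x = 0"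
    and fc: "\<And>i. i < m \<Longrightarrow> f x (e i m) = 0" and fr: "\<And>i. i < m \<Longrightarrow> f x (e m i) = 0"
    and fh: "f x (e 0 m \<star> e m 0) = 0"
    and y: "y \<in> lie_generated smul bracket (offdiag e {..<Suc m})"
  shows "f x y = 0"
proof -
  let ?N = "{y \<in> L. f x y = 0}"
  have N: "subspace ?N" using x by (auto simp: subspace_def f_linear)
  have "diag_ext m e i j \<in> ?N" if ij: "i < Suc m" "j < Suc m" for i j
  proof (cases "i = j")
    case False
    have Lij: "e i j \<in> L" using ext ij False by auto
    have "f x (e i j) = 0"
    proof (cases "i = m \<or> j = m")
      case True
      then show ?thesis using fc fr ij False by auto
    next
      case f2: False
      hence "e i j \<star> x = 0" using xc ij False by simp
      hence "x \<star> e i j = 0" using bracket_skew[of x "e i j"] by simp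
      thus ?thesis using Lij x by (intro f_eq_0_centralizer)
    qed
    thus ?thesis using False Lij by (simp add: diag_ext_off)
  next
    case True
    show ?thesis
    proof (cases "i = m")
      case False
      have "f x (e i m \<star> e m i) = f x (e 0 m \<star> e m 0)"
        using False ij m by (intro f_cartan_eq[OF st ext x xc]) auto
      thus ?thesis using True False ij fh ext[of i m] ext[of m i] by (auto simp: diag_ext_def)
    qed (use True x in \<open>auto simp: diag_ext_def\<close>)
  qed
  hence "matrix_sum {..<Suc m} (diag_ext m e) A \<in> ?N" for A
    unfolding matrix_sum_def by (intro subspace_sum[OF N] subspace_scale[OF N]) auto
  thus ?thesis using y unfolding lie_generated_offdiag[OF st, of m, simplified] by auto
qed

end

section \<open>Realizations of the graph\<close>

lemma quadratic_root:
  fixes a b c :: "'k::alg_closed_field"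
  assumes "a \<noteq> 0 \<or> b \<noteq> 0"
  shows "\<exists>z. a * z\<^sup>2 + b * z + c = 0"
proof -
  have "degree [:c, b, a:] > 0" using assms by auto
  then obtain z where "poly [:c, b, a:] z = 0" using alg_closed_imp_poly_has_root by blast
  thus ?thesis by (intro exI[of _ z]) (simp add: power2_eq_square algebra_simps)
qed

text \<open>The bound \<open>4 \<le> j\<close> excludes the pair 1, 3, which is joined by the
  additional edge; all other nonconsecutive pairs are covered.\<close>

locale generic_realization = extremal_algebra smul bracket L f
  for smul :: "'k::alg_closed_field \<Rightarrow> 'v::ab_group_add \<Rightarrow> 'v" (infixr "\<odot>" 75)
    and bracket :: "'v \<Rightarrow> 'v \<Rightarrow> 'v" (infixr "\<star>" 70)
    and L :: "'v set" and f :: "'v \<Rightarrow> 'v \<Rightarrow> 'k" +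
  fixes n :: nat and x :: "nat \<Rightarrow> 'v"
  assumes x_ext: "i \<in> {1..n} \<Longrightarrow> ext (x i)"
    and x_commute: "i \<in> {1..n} \<Longrightarrow> j \<in> {1..n} \<Longrightarrow> i + 1 < j \<Longrightarrow> 4 \<le> j \<Longrightarrow> x i \<star> x j = 0"
    and triangle: "(f (x 1) (x 2 \<star> x 3))\<^sup>2 \<noteq> 2 * f (x 1) (x 2) * f (x 1) (x 3) * f (x 2) (x 3)"
    and path: "1 \<le> i \<Longrightarrow> i < n \<Longrightarrow> f (x i) (x (i + 1)) \<noteq> 0"
begin

definition system :: "nat \<Rightarrow> (nat \<Rightarrow> nat \<Rightarrow> 'v) \<Rightarrow> bool" where
  "system m e \<longleftrightarrow> steinberg {..<m} e \<and> (\<forall>i<m. \<forall>j<m. i \<noteq> j \<longrightarrow> ext (e i j)) \<and>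
    lie_generated smul bracket (offdiag e {..<m}) = lie_generated smul bracket (x ` {1..m})"

lemma lie_generated_insert_cong:
  assumes "lie_generated smul bracket A = lie_generated smul bracket B"
  shows "lie_generated smul bracket (insert y A) = lie_generated smul bracket (insert y B)"
proof -
  have "lie_generated smul bracket (insert y A) \<subseteq> lie_generated smul bracket (insert y B)"
    if "lie_generated smul bracket A = lie_generated smul bracket B" for A B
  proof (rule lie_generated_least[OF lie_generated_subalgebra])
    have "A \<subseteq> lie_generated smul bracket B" using that lie_generated_superset by metis
    also have "\<dots> \<subseteq> lie_generated smul bracket (insert y B)"
      using lie_generated_superset[of "insert y B"]
      by (intro lie_generated_least[OF lie_generated_subalgebra]) auto
    finally show "insert y A \<subseteq> lie_generated smul bracket (insert y B)"
      using lie_generated_superset[of "insert y B"] by auto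
  qed
  thus ?thesis using assms by blast
qed

lemma base_system:
  assumes n: "n \<ge> 3"
  shows "\<exists>e. system 3 e \<and>
    lie_generated smul bracket (offdiag e {..<2}) = lie_generated smul bracket (x ` {1..2})"
proof -
  have ex: "ext (x 1)" "ext (x 2)" "ext (x 3)" using x_ext n by auto
  hence L: "x 1 \<in> L" "x 2 \<in> L" "x 3 \<in> L" by auto
  \<comment> \<open>Invariance rotates the triangle condition so that it speaks of the functional of
    \<open>x 3\<close> on the pair \<open>x 1\<close>, \<open>x 2\<close>.\<close>
  have "f (x 3) (x 1 \<star> x 2) = f (x 1) (x 2 \<star> x 3)"
    using f_sym[of "x 3" "x 1 \<star> x 2"] f_assoc[of "x 1" "x 2" "x 3"] L by simp
  moreover have "f (x 3) (x 1) = f (x 1) (x 3)" "f (x 3) (x 2) = f (x 2) (x 3)"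
    using f_sym L by blast+
  ultimately have disc: "(f (x 3) (x 1 \<star> x 2))\<^sup>2 \<noteq> 2 * f (x 1) (x 2) * f (x 3) (x 1) * f (x 3) (x 2)"
    using triangle by simp
  have r0: "f (x 1) (x 2) \<noteq> 0" using path[of 1] n by (simp add: numeral_2_eq_2)
  obtain a b where ab: "ext a" "ext b" "(a \<star> b) \<star> a = a + a" "(b \<star> a) \<star> b = b + b"
    "f (x 3) a = 0" "f (x 3) b = 0" "f (x 3) (a \<star> b) \<noteq> 0"
    "lie_generated smul bracket {a, b} = lie_generated smul bracket {x 1, x 2}"
    by (rule adapted_pair[OF quadratic_root ex(1,2) L(3) r0 disc])
  define e where "e = (\<lambda>(i :: nat) (j :: nat). if i = 0 then a else b)"
  have two: "2 = Suc 1" "3 = Suc (Suc 1)" by simp_all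
  have st: "steinberg {..<Suc 1} e"
    using steinberg_pair[OF ab(3,4)] unfolding e_def two(1)[symmetric] .
  have ext_e: "ext (e i j)" for i j using ab by (simp add: e_def)
  have zero: "f (x 3) (e i j) = 0" for i j using ab by (simp add: e_def)
  have e01: "e 0 1 = a" "e 1 0 = b" by (simp_all add: e_def)
  have nz: "f (x 3) (e 0 1 \<star> e 1 0) \<noteq> 0" unfolding e01 by (rule ab(7))
  have no: "e i j \<star> x 3 = 0" if "i < 1" "j < 1" "i \<noteq> j" for i j using that by simp
  have "\<exists>e'. steinberg {..<Suc (Suc 1)} e' \<and>
    (\<forall>i<Suc (Suc 1). \<forall>j<Suc (Suc 1). i \<noteq> j \<longrightarrow> ext (e' i j)) \<and>
    lie_generated smul bracket (offdiag e' {..<Suc (Suc 1)}) =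
      lie_generated smul bracket (insert (x 3) (offdiag e {..<Suc 1})) \<and>
    offdiag e' {..<Suc 1} = offdiag e {..<Suc 1}"
    by (rule extend_system[OF order_refl st _ ex(3) _ _ _ nz]) (rule ext_e no zero; assumption?)+
  then obtain e' where e': "steinberg {..<Suc (Suc 1)} e'"
    "\<forall>i<Suc (Suc 1). \<forall>j<Suc (Suc 1). i \<noteq> j \<longrightarrow> ext (e' i j)"
    "lie_generated smul bracket (offdiag e' {..<Suc (Suc 1)}) =
      lie_generated smul bracket (insert (x 3) (offdiag e {..<Suc 1}))"
    "offdiag e' {..<Suc 1} = offdiag e {..<Suc 1}"
    by blast
  have off: "offdiag e {..<2} = {a, b}"
  proof -
    have "{..<2} = {0, 1 :: nat}" by auto
    hence "offdiag e {..<2} = {e 0 1, e 1 0}" unfolding offdiag_def by auto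
    thus ?thesis by (simp only: e01)
  qed
  have x2: "x ` {1..2} = {x 1, x 2}" "x ` {1..3} = insert (x 3) (x ` {1..2})"
  proof -
    have "{1..2} = {1, 2 :: nat}" "{1..3} = {3, 1, 2 :: nat}" by auto
    thus "x ` {1..2} = {x 1, x 2}" "x ` {1..3} = insert (x 3) (x ` {1..2})" by auto
  qed
  have g2: "lie_generated smul bracket (offdiag e {..<2}) = lie_generated smul bracket (x ` {1..2})"
    using ab(8) by (simp only: off x2)
  have "lie_generated smul bracket (offdiag e' {..<3}) =
      lie_generated smul bracket (insert (x 3) (offdiag e {..<2}))"
    using e'(3) by (simp only: two)
  also have "\<dots> = lie_generated smul bracket (x ` {1..3})"
    unfolding x2(2) by (rule lie_generated_insert_cong[OF g2])
  finally have "lie_generated smul bracket (offdiag e' {..<3}) = lie_generated smul bracket (x ` {1..3})" .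
  hence "system 3 e'" unfolding system_def using e'(1,2) by (simp only: two)
  moreover have "offdiag e' {..<2} = offdiag e {..<2}" using e'(4) by (simp only: two)
  ultimately show ?thesis using g2 by metis
qed

lemma step_system:
  assumes m: "m \<ge> 2" "Suc (Suc m) \<le> n" and sys: "system (Suc m) e"
    and gen: "lie_generated smul bracket (offdiag e {..<m}) = lie_generated smul bracket (x ` {1..m})"
  shows "\<exists>e'. system (Suc (Suc m)) e' \<and>
    lie_generated smul bracket (offdiag e' {..<Suc m}) = lie_generated smul bracket (x ` {1..Suc m})"
proof -
  let ?X = "x (Suc (Suc m))"
  have st: "steinberg {..<Suc m} e"
    and ext: "\<And>i j. i < Suc m \<Longrightarrow> j < Suc m \<Longrightarrow> i \<noteq> j \<Longrightarrow> ext (e i j)"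
    and gen1: "lie_generated smul bracket (offdiag e {..<Suc m}) = lie_generated smul bracket (x ` {1..Suc m})"
    using sys by (auto simp: system_def)
  have X: "ext ?X" using x_ext m by simp
  have L: "e i j \<in> L" if "i < Suc m" "j < Suc m" "i \<noteq> j" for i j using ext[OF that] by auto
  have "lie_generated smul bracket (x ` {1..m}) \<subseteq> {c. c \<star> ?X = 0}"
    by (rule lie_generated_least[OF lie_subalgebra_centralizer]) (use m x_commute in auto)
  moreover have "e i j \<in> lie_generated smul bracket (offdiag e {..<m})"
    if "i < m" "j < m" "i \<noteq> j" for i j
    by (rule subsetD[OF lie_generated_superset]) (use that in \<open>auto simp: offdiag_def\<close>)
  ultimately have xc: "e i j \<star> ?X = 0" if "i < m" "j < m" "i \<noteq> j" for i j
    using that gen by blast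
  have xc': "?X \<star> e i j = 0" if "i < m" "j < m" "i \<noteq> j" for i j
    using xc[OF that] bracket_skew[of ?X "e i j"] by simp
  \<comment> \<open>As \<open>m \<ge> 2\<close>, there is a second index j below m. Then
    \<open>e i m\<close> and \<open>e m i\<close> are, up to sign, brackets with a factor that
    commutes with \<open>?X\<close>, so invariance makes them orthogonal to
    \<open>?X\<close>.\<close>
  have f: "f ?X (e i m) = 0 \<and> f ?X (e m i) = 0" if i: "i < m" for i
  proof -
    obtain j where j: "j < m" "j \<noteq> i"
    proof (cases "i = 0")
      case True thus ?thesis using m that[of 1] by simp
    next
      case False thus ?thesis using m that[of 0] by simp
    qed
    have "e i m = e i j \<star> e j m" using steinberg_mult[OF st, of i j m] i j by simp
    hence 1: "f ?X (e i m) = 0"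
      using f_centralizer[OF xc'[of i j], of "e j m"] L i j X by (simp add: ext_in)
    have "e m i = - (e j i \<star> e m j)" using steinberg_mult'[OF st, of m j i] i j by simp
    hence "f ?X (e m i) = 0"
      using f_centralizer[OF xc'[of j i], of "e m j"] L i j X by (simp add: ext_in)
    thus ?thesis using 1 by simp
  qed
  \<comment> \<open>Otherwise \<open>?X\<close> would be orthogonal to everything generated so far,
    in particular to its predecessor on the path.\<close>
  have fh: "f ?X (e 0 m \<star> e m 0) \<noteq> 0"
  proof
    assume 0: "f ?X (e 0 m \<star> e m 0) = 0"
    have mem: "x (Suc m) \<in> lie_generated smul bracket (offdiag e {..<Suc m})"
      unfolding gen1 by (rule subsetD[OF lie_generated_superset]) simp
    have "f ?X (x (Suc m)) = 0"
      by (rule f_eq_0_generated[OF _ st ext X xc _ _ 0 mem]) (use f m in auto)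
    moreover have "f ?X (x (Suc m)) = f (x (Suc m)) ?X"
      using X x_ext[of "Suc m"] m by (intro f_sym ext_in) auto
    ultimately show False using path[of "Suc m"] m by simp
  qed
  have m1: "m \<ge> 1" using m by simp
  have "\<exists>e'. steinberg {..<Suc (Suc m)} e' \<and>
    (\<forall>i<Suc (Suc m). \<forall>j<Suc (Suc m). i \<noteq> j \<longrightarrow> ext (e' i j)) \<and>
    lie_generated smul bracket (offdiag e' {..<Suc (Suc m)}) =
      lie_generated smul bracket (insert (?X) (offdiag e {..<Suc m})) \<and>
    offdiag e' {..<Suc m} = offdiag e {..<Suc m}"
    by (rule extend_system[OF m1 st _ X _ _ _ fh]) (use ext xc f in blast)+
  then obtain e' where e': "steinberg {..<Suc (Suc m)} e'"
    "\<forall>i<Suc (Suc m). \<forall>j<Suc (Suc m). i \<noteq> j \<longrightarrow> ext (e' i j)"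
    "lie_generated smul bracket (offdiag e' {..<Suc (Suc m)}) =
      lie_generated smul bracket (insert (?X) (offdiag e {..<Suc m}))"
    "offdiag e' {..<Suc m} = offdiag e {..<Suc m}"
    by blast
  have "x ` {1..Suc (Suc m)} = insert ?X (x ` {1..Suc m})" by (auto simp: atLeastAtMostSuc_conv)
  hence "lie_generated smul bracket (offdiag e' {..<Suc (Suc m)}) = lie_generated smul bracket (x ` {1..Suc (Suc m)})"
    using e'(3) lie_generated_insert_cong[OF gen1, of ?X] by simp
  hence "system (Suc (Suc m)) e'" unfolding system_def using e'(1,2) by blast
  thus ?thesis using e'(4) gen1 by auto
qed

text \<open>The induction statement has two levels: besides the system of size m + 1, its block of
  size m must generate the subalgebra of \<open>x 1\<close> to \<open>x m\<close>, since that is the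
  part centralized by the next generator.\<close>

lemma exists_system:
  assumes "n \<ge> 3"
  shows "\<exists>e. system n e"
proof -
  have "Suc m \<le> n \<longrightarrow> (\<exists>e. system (Suc m) e \<and>
    lie_generated smul bracket (offdiag e {..<m}) = lie_generated smul bracket (x ` {1..m}))"
    if "m \<ge> 2" for m
    using that
  proof (induction m rule: dec_induct)
    case base
    then show ?case using base_system[OF assms] by (simp add: numeral_3_eq_3 numeral_2_eq_2)
  next
    case (step m)
    then show ?case using step_system[of m] by auto
  qed
  moreover have "n - 1 \<ge> 2" "Suc (n - 1) = n" using assms by simp_all
  ultimately show ?thesis by (metis order_refl)
qed

end

section \<open>Ideals and images of the special linear algebra\<close>

no_notation fps_nth (infixl "$" 75)

definition unit_mat :: "'n::finite \<Rightarrow> 'n \<Rightarrow> 'k::field^'n^'n" where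
  "unit_mat i j = (\<chi> a b. if a = i \<and> b = j then 1 else 0)"

lemma unit_mat_nth: "unit_mat i j $ a $ b = (if a = i \<and> b = j then 1 else 0)"
  by (simp add: unit_mat_def)

lemma unit_mat_mult:
  "(unit_mat i j ** A) $ a $ b = (if a = i then A $ j $ b else 0)"
  "(A ** unit_mat i j) $ a $ b = (if b = j then A $ a $ i else 0)"
proof -
  have "(unit_mat i j ** A) $ a $ b = (\<Sum>k\<in>UNIV. unit_mat i j $ a $ k * A $ k $ b)"
    by (simp add: matrix_matrix_mult_def)
  also have "\<dots> = (\<Sum>k\<in>UNIV. if k = j then (if a = i then A $ k $ b else 0) else 0)"
    by (intro sum.cong refl) (simp add: unit_mat_nth)
  finally show "(unit_mat i j ** A) $ a $ b = (if a = i then A $ j $ b else 0)" by simp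
  have "(A ** unit_mat i j) $ a $ b = (\<Sum>k\<in>UNIV. A $ a $ k * unit_mat i j $ k $ b)"
    by (simp add: matrix_matrix_mult_def)
  also have "\<dots> = (\<Sum>k\<in>UNIV. if k = i then (if b = j then A $ a $ k else 0) else 0)"
    by (intro sum.cong refl) (simp add: unit_mat_nth)
  finally show "(A ** unit_mat i j) $ a $ b = (if b = j then A $ a $ i else 0)" by simp
qed

lemma mat_bracket_unit:
  "mat_bracket (unit_mat i j) A $ a $ b =
    (if a = i then A $ j $ b else 0) - (if b = j then A $ a $ i else 0)"
  by (simp add: mat_bracket_def unit_mat_mult)

lemma mat_scale_nth: "mat_scale c A $ a $ b = c * A $ a $ b"
  by (simp add: mat_scale_def)

lemma trace_unit_mat: "i \<noteq> j \<Longrightarrow> trace (unit_mat i j) = 0"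
  by (auto simp: trace_def unit_mat_nth intro!: sum.neutral)

lemma sl_simps [simp]:
  "lcarrier sl = {A. trace A = 0}" "lzero sl = 0" "ladd sl = (+)" "lscale sl = mat_scale"
  "lbracket sl = mat_bracket"
  by (simp_all add: sl_def lie_alg_on_def)

lemma exists_third:
  assumes "CARD('n::finite) \<ge> 3"
  shows "\<exists>k :: 'n. k \<noteq> i \<and> k \<noteq> j"
proof (rule ccontr)
  assume "\<not> ?thesis"
  hence "(UNIV :: 'n set) \<subseteq> {i, j}" by auto
  hence "CARD('n) \<le> card {i, j}" by (intro card_mono) auto
  also have "\<dots> \<le> 2" by (simp add: card_insert_if)
  finally show False using assms by simp
qed

text \<open>Brackets with matrix units change one index at a time, but must avoid the diagonal. A
  unit in column \<open>p\<close> is therefore reached through a third column, which exists for size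
  at least 3.\<close>

lemma ideal_sl_full:
  fixes I :: "('k::field^'n::finite^'n) set"
  assumes I: "lie_ideal sl I" and n: "CARD('n) \<ge> 3" and pq: "p \<noteq> q" and e: "unit_mat p q \<in> I"
  shows "I = {A. trace A = 0}"
proof -
  have sub: "I \<subseteq> {A. trace A = 0}" and zero: "0 \<in> I"
    and add: "\<And>a b. a \<in> I \<Longrightarrow> b \<in> I \<Longrightarrow> a + b \<in> I" and scale: "\<And>c a. a \<in> I \<Longrightarrow> mat_scale c a \<in> I"
    and left: "\<And>a b. trace a = 0 \<Longrightarrow> b \<in> I \<Longrightarrow> mat_bracket a b \<in> I"
    using I by (auto simp: lie_ideal_def)
  have right_step: "unit_mat i k \<in> I" if "unit_mat i j \<in> I" "i \<noteq> j" "i \<noteq> k" for i j k :: 'n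
  proof (cases "j = k")
    case False
    have "mat_bracket (unit_mat j k) (unit_mat i j) = mat_scale (- 1) (unit_mat i k)"
      using that False by (simp add: vec_eq_iff mat_bracket_unit unit_mat_nth mat_scale_nth)
    moreover have "mat_scale (- 1) (mat_scale (- 1) A) = A" for A :: "'k^'n^'n"
      by (simp add: vec_eq_iff mat_scale_nth)
    ultimately show ?thesis
      using scale[OF left[OF trace_unit_mat[OF False] that(1)], of "- 1"] by metis
  qed (use that in simp)
  have left_step: "unit_mat k j \<in> I" if "unit_mat i j \<in> I" "i \<noteq> j" "k \<noteq> j" for i j k :: 'n
  proof (cases "i = k")
    case False
    have "mat_bracket (unit_mat k i) (unit_mat i j) = unit_mat k j"
      using that False by (simp add: vec_eq_iff mat_bracket_unit unit_mat_nth)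
    thus ?thesis using left[OF trace_unit_mat that(1), of k i] False by metis
  qed (use that in simp)
  have unit: "unit_mat k l \<in> I" if "k \<noteq> l" for k l
  proof (cases "l = p")
    case True
    obtain t where t: "t \<noteq> p" "t \<noteq> k" using exists_third[OF n] by blast
    have "unit_mat p t \<in> I" using right_step[OF e pq, of t] t by simp
    hence "unit_mat k t \<in> I" using left_step[of p t k] t by simp
    thus ?thesis using right_step[of k t l] t that True by simp
  next
    case False
    have "unit_mat p l \<in> I" using right_step[OF e pq, of l] False by simp
    thus ?thesis using left_step[of p l k] False that by simp
  qed
  have diag: "unit_mat i i - unit_mat j j \<in> I" for i j
  proof (cases "i = j")
    case False
    have "mat_bracket (unit_mat i j) (unit_mat j i) = unit_mat i i - unit_mat j j"
      by (auto simp: vec_eq_iff mat_bracket_unit unit_mat_nth)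
    thus ?thesis using left[OF trace_unit_mat[OF False] unit[of j i]] False by metis
  qed (use zero in simp)
  have sum: "sum g S \<in> I" if "\<And>s. s \<in> S \<Longrightarrow> g s \<in> I" for g and S :: "'n set"
    using that by (induction S rule: infinite_finite_induct) (auto intro: zero add)
  have "A \<in> I" if "trace A = 0" for A :: "'k^'n^'n"
  proof -
    define b :: 'n where "b = p"
    \<comment> \<open>The subtracted copies of E_bb add up to the trace of \<open>A\<close> times
      E_bb, which is zero.\<close>
    have "A = (\<Sum>i\<in>UNIV. \<Sum>j\<in>UNIV. mat_scale (A $ i $ j)
        (if i = j then unit_mat i i - unit_mat b b else unit_mat i j))" (is "A = ?S")
    proof -
      have "?S $ k $ l = A $ k $ l" for k l
      proof -
        have "?S $ k $ l = (\<Sum>i\<in>UNIV. \<Sum>j\<in>UNIV. A $ i $ j * (unit_mat i j $ k $ l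
            - (if i = j then unit_mat b b $ k $ l else 0)))"
          by (simp add: mat_scale_nth) (intro sum.cong refl, simp add: mat_scale_nth)
        also have "\<dots> = (\<Sum>i\<in>UNIV. \<Sum>j\<in>UNIV. A $ i $ j * unit_mat i j $ k $ l)
            - (\<Sum>i\<in>UNIV. \<Sum>j\<in>UNIV. if i = j then A $ i $ j * unit_mat b b $ k $ l else 0)"
          by (simp only: sum_subtractf[symmetric]) (intro sum.cong refl, simp add: right_diff_distrib)
        also have "(\<Sum>i\<in>UNIV. \<Sum>j\<in>UNIV. if i = j then A $ i $ j * unit_mat b b $ k $ l else 0) =
            trace A * unit_mat b b $ k $ l"
          by (simp add: trace_def sum_distrib_right)
        also have "(\<Sum>i\<in>UNIV. \<Sum>j\<in>UNIV. A $ i $ j * unit_mat i j $ k $ l) =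
            (\<Sum>i\<in>UNIV. if k = i then (\<Sum>j\<in>UNIV. if l = j then A $ i $ j else 0) else 0)"
          by (intro sum.cong refl)
            (simp add: unit_mat_nth if_distrib[of "(*) _"] cong: if_cong)
        finally show ?thesis using that by simp
      qed
      thus ?thesis by (simp add: vec_eq_iff)
    qed
    moreover have "?S \<in> I" by (intro sum scale) (simp add: unit diag)
    ultimately show ?thesis by simp
  qed
  thus ?thesis using sub by blast
qed

text \<open>A nonscalar member yields a matrix unit. If its (j,i) entry is nonzero off the diagonal,
  bracketing twice with E_ij leaves -2 times that entry times E_ij; if it is diagonal, one bracket
  leaves the difference of two diagonal entries times E_ij.\<close>

lemma ideal_sl:
  fixes I :: "('k::field^'n::finite^'n) set"
  assumes I: "lie_ideal sl I" and n: "CARD('n) \<ge> 3" and two: "(2 :: 'k) \<noteq> 0"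
  shows "I = {A. trace A = 0} \<or> I \<subseteq> range (\<lambda>c. mat_scale c (mat 1))"
proof (cases "\<exists>A\<in>I. \<exists>i j. i \<noteq> j \<and> (A $ i $ j \<noteq> 0 \<or> A $ i $ i \<noteq> A $ j $ j)")
  case False
  have "A = mat_scale (A $ undefined $ undefined) (mat 1)" if "A \<in> I" for A
    using False that by (auto simp: vec_eq_iff mat_scale_nth mat_def) metis+
  thus ?thesis by blast
next
  case True
  have scale: "\<And>c a. a \<in> I \<Longrightarrow> mat_scale c a \<in> I"
    and left: "\<And>a b. trace a = 0 \<Longrightarrow> b \<in> I \<Longrightarrow> mat_bracket a b \<in> I"
    using I by (auto simp: lie_ideal_def)
  have unit: "unit_mat i j \<in> I" if "mat_scale c (unit_mat i j) \<in> I" "c \<noteq> 0" for i j c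
  proof -
    have "mat_scale (inverse c) (mat_scale c (unit_mat i j)) = (unit_mat i j :: 'k^'n^'n)"
      using that by (simp add: vec_eq_iff mat_scale_nth)
    thus ?thesis using scale[OF that(1), of "inverse c"] by simp
  qed
  from True obtain A where A: "A \<in> I" "\<exists>i j. i \<noteq> j \<and> (A $ i $ j \<noteq> 0 \<or> A $ i $ i \<noteq> A $ j $ j)" by blast
  have "\<exists>i j. i \<noteq> j \<and> unit_mat i j \<in> I"
  proof (cases "\<exists>i j. i \<noteq> j \<and> A $ i $ j \<noteq> 0")
    case True
    then obtain i j where ij: "i \<noteq> j" "A $ j $ i \<noteq> 0" by metis
    have "mat_bracket (unit_mat i j) (mat_bracket (unit_mat i j) A) = mat_scale (- 2 * A $ j $ i) (unit_mat i j)"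
      using ij by (auto simp: vec_eq_iff mat_bracket_unit unit_mat_nth mat_scale_nth)
    moreover have "mat_bracket (unit_mat i j) (mat_bracket (unit_mat i j) A) \<in> I"
      using ij A by (intro left trace_unit_mat) auto
    ultimately show ?thesis using unit[of "- 2 * A $ j $ i" i j] ij two by auto
  next
    case False
    then obtain i j where ij: "i \<noteq> j" "A $ i $ i \<noteq> A $ j $ j" using A by blast
    have z: "A $ a $ b = 0" if "a \<noteq> b" for a b using False that by blast
    have "mat_bracket (unit_mat i j) A = mat_scale (A $ j $ j - A $ i $ i) (unit_mat i j)"
      using ij by (auto simp: z vec_eq_iff mat_bracket_unit unit_mat_nth mat_scale_nth)
    moreover have "mat_bracket (unit_mat i j) A \<in> I"
      using ij A by (intro left trace_unit_mat) auto
    ultimately show ?thesis using unit[of "A $ j $ j - A $ i $ i" i j] ij by auto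
  qed
  thus ?thesis using ideal_sl_full[OF I n] by blast
qed

section \<open>Kernel and image of a homomorphism from the special linear algebra\<close>

locale sl_image = lie_algebra smul bracket
  for smul :: "'k::field \<Rightarrow> 'v::ab_group_add \<Rightarrow> 'v" (infixr "\<odot>" 75)
    and bracket :: "'v \<Rightarrow> 'v \<Rightarrow> 'v" (infixr "\<star>" 70) +
  fixes \<phi> :: "'k^'n::finite^'n \<Rightarrow> 'v" and L :: "'v set"
  assumes \<phi>_add: "\<phi> (A + B) = \<phi> A + \<phi> B"
    and \<phi>_scale: "\<phi> (mat_scale c A) = c \<odot> \<phi> A"
    and \<phi>_bracket: "trace A = 0 \<Longrightarrow> trace B = 0 \<Longrightarrow> \<phi> (mat_bracket A B) = \<phi> A \<star> \<phi> B"
    and \<phi>_image: "\<phi> ` {A. trace A = 0} = L"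
    and L_nonzero: "L \<noteq> {0}"
    and two: "(2 :: 'k) \<noteq> 0"
    and card: "CARD('n) \<ge> 3"
begin

definition K :: "('k^'n^'n) set" where "K = {A. trace A = 0 \<and> \<phi> A = 0}"

text \<open>These are the cosets of \<open>K\<close>, labelled by their image in \<open>L\<close>;
  the quotient can then be handled without choosing representatives.\<close>

definition fibre :: "'v \<Rightarrow> ('k^'n^'n) set" where "fibre v = {A. trace A = 0 \<and> \<phi> A = v}"

abbreviation image_alg :: "('k, 'v) lie_alg" where "image_alg \<equiv> lie_alg_on smul bracket L"

lemma image_alg_simps [simp]: "lcarrier image_alg = L" "lzero image_alg = 0" "ladd image_alg = (+)" "lscale image_alg = smul"
    "lbracket image_alg = bracket"
  by (simp_all add: lie_alg_on_def)

lemma tr [simp]: "trace (mat_scale c A) = c * trace A" "trace (mat_bracket A B) = 0"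
    for A B :: "'k^'n^'n"
  by (simp add: trace_def mat_scale_def sum_distrib_left)
    (simp add: mat_bracket_def trace_sub trace_mul_sym[of A B])

lemma \<phi>_0 [simp]: "\<phi> 0 = 0"
  using \<phi>_add[of 0 0] by simp

lemma \<phi>_diff: "\<phi> (A - B) = \<phi> A - \<phi> B"
  using \<phi>_add[of "A - B" B] by simp

lemma obtain_preimage: assumes "v \<in> L" obtains A where "trace A = 0" "\<phi> A = v"
  using assms \<phi>_image by blast

lemma in_L [simp]: "trace A = 0 \<Longrightarrow> \<phi> A \<in> L"
  using \<phi>_image by blast

lemma K_ideal: "lie_ideal sl K"
  by (auto simp: lie_ideal_def K_def \<phi>_add \<phi>_scale \<phi>_bracket trace_add trace_0[simplified])

lemma K_scalar: "K \<subseteq> range (\<lambda>c. mat_scale c (mat 1))"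
proof -
  have "K \<noteq> {A. trace A = 0}"
  proof
    assume "K = {A. trace A = 0}"
    hence "\<phi> ` {A. trace A = 0} \<subseteq> {0}" by (auto simp: K_def)
    thus False using L_nonzero \<phi>_image \<phi>_0 trace_0 by (metis (mono_tags, lifting) image_is_empty mem_Collect_eq empty_iff subset_singletonD)
  qed
  thus ?thesis using ideal_sl[OF K_ideal card two] by blast
qed

lemma isomorphic_sl:
  assumes "K = {0}"
  shows "lie_isomorphic image_alg (sl :: ('k, 'k^'n^'n) lie_alg)"
proof -
  let ?S = "{A :: 'k^'n^'n. trace A = 0}"
  have inj: "inj_on \<phi> ?S"
  proof (rule inj_onI)
    fix A B assume "A \<in> ?S" "B \<in> ?S" "\<phi> A = \<phi> B"
    hence "A - B \<in> K" by (simp add: K_def \<phi>_diff trace_sub)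
    thus "A = B" using assms by simp
  qed
  define \<psi> where "\<psi> = the_inv_into ?S \<phi>"
  have \<psi>: "\<psi> (\<phi> A) = A" if "trace A = 0" for A
    unfolding \<psi>_def using the_inv_into_f_f[OF inj] that by simp
  have "bij_betw \<psi> L ?S"
    unfolding \<psi>_def using inj \<phi>_image by (intro bij_betw_the_inv_into) (simp add: bij_betw_def)
  moreover have "\<psi> (a + b) = \<psi> a + \<psi> b" "\<psi> (a \<star> b) = mat_bracket (\<psi> a) (\<psi> b)"
    if ab: "a \<in> L" "b \<in> L" for a b
  proof -
    obtain A B where AB: "trace A = 0" "\<phi> A = a" "trace B = 0" "\<phi> B = b"
      using obtain_preimage ab by metis
    show "\<psi> (a + b) = \<psi> a + \<psi> b" "\<psi> (a \<star> b) = mat_bracket (\<psi> a) (\<psi> b)"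
      using \<psi>[of "A + B"] \<psi>[of "mat_bracket A B"] \<psi>[OF AB(1)] \<psi>[OF AB(3)] AB
      by (simp_all add: \<phi>_add \<phi>_bracket trace_add)
  qed
  moreover have "\<psi> (c \<odot> a) = mat_scale c (\<psi> a)" if "a \<in> L" for a c
  proof -
    obtain A where A: "trace A = 0" "\<phi> A = a" using obtain_preimage \<open>a \<in> L\<close> by metis
    show ?thesis using \<psi>[of "mat_scale c A"] \<psi>[OF A(1)] A by (simp add: \<phi>_scale)
  qed
  ultimately show ?thesis unfolding lie_isomorphic_def by auto
qed

lemma coset_eq: assumes "trace A = 0" shows "lie_coset sl K A = fibre (\<phi> A)"
proof
  show "lie_coset sl K A \<subseteq> fibre (\<phi> A)"
    using assms by (auto simp: lie_coset_def K_def fibre_def \<phi>_add trace_add)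
  show "fibre (\<phi> A) \<subseteq> lie_coset sl K A"
  proof
    fix B assume "B \<in> fibre (\<phi> A)"
    hence "B - A \<in> K" "B = A + (B - A)" using assms by (simp_all add: K_def fibre_def \<phi>_diff trace_sub)
    thus "B \<in> lie_coset sl K A" unfolding lie_coset_def sl_simps by (intro image_eqI)
  qed
qed

abbreviation Q :: "('k, ('k^'n^'n) set) lie_alg" where "Q \<equiv> lie_quotient sl K"

lemma fibre_nonempty: "v \<in> L \<Longrightarrow> fibre v \<noteq> {}"
  using \<phi>_image by (auto simp: fibre_def)

lemma fibre_inj: "inj_on fibre L"
proof (rule inj_onI)
  fix v w assume "v \<in> L" "w \<in> L" "fibre v = fibre w"
  thus "v = w" using fibre_nonempty[of v] unfolding fibre_def by blast
qed

lemma Q_carrier: "lcarrier Q = fibre ` L"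
proof -
  have "lcarrier Q = (\<lambda>A. fibre (\<phi> A)) ` {A. trace A = 0}"
    unfolding lie_quotient_def using coset_eq by simp
  thus ?thesis using \<phi>_image by (simp add: image_image[symmetric])
qed

lemma Q_zero: "lzero Q = fibre 0"
  using coset_eq[of 0] trace_0 by (simp add: lie_quotient_def)

lemma UN_const: "S \<noteq> {} \<Longrightarrow> (\<And>s. s \<in> S \<Longrightarrow> F s = X) \<Longrightarrow> (\<Union>s\<in>S. F s) = X"
  by auto

lemma Q_ops:
  assumes "v \<in> L" "w \<in> L"
  shows "ladd Q (fibre v) (fibre w) = fibre (v + w)"
    and "lbracket Q (fibre v) (fibre w) = fibre (v \<star> w)"
    and "lscale Q c (fibre v) = fibre (c \<odot> v)"
proof -
  have "lie_coset sl K (A + B) = fibre (v + w)" "lie_coset sl K (mat_bracket A B) = fibre (v \<star> w)"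
    "lie_coset sl K (mat_scale c A) = fibre (c \<odot> v)"
    if "A \<in> fibre v" "B \<in> fibre w" for A B
    using that by (simp_all add: fibre_def coset_eq trace_add \<phi>_add \<phi>_bracket \<phi>_scale)
  note * = this
  note ne = fibre_nonempty[OF assms(1)] fibre_nonempty[OF assms(2)]
  show "ladd Q (fibre v) (fibre w) = fibre (v + w)"
    "lbracket Q (fibre v) (fibre w) = fibre (v \<star> w)"
    "lscale Q c (fibre v) = fibre (c \<odot> v)"
    unfolding lie_quotient_def lie_alg.simps sl_simps
    using * ne by (intro UN_const; blast)+
qed

lemma Q_scale: "v \<in> L \<Longrightarrow> lscale Q c (fibre v) = fibre (c \<odot> v)"
  by (rule Q_ops(3))

lemma L_closed: "a \<in> L \<Longrightarrow> b \<in> L \<Longrightarrow> a + b \<in> L" "a \<in> L \<Longrightarrow> c \<odot> a \<in> L"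
    "a \<in> L \<Longrightarrow> b \<in> L \<Longrightarrow> a \<star> b \<in> L"
proof -
  show "c \<odot> a \<in> L" if a: "a \<in> L"
  proof -
    obtain A where "trace A = 0" "\<phi> A = a" using obtain_preimage[OF a] by blast
    thus ?thesis using in_L[of "mat_scale c A"] by (simp add: \<phi>_scale)
  qed
  show "a + b \<in> L" "a \<star> b \<in> L" if ab: "a \<in> L" "b \<in> L"
  proof -
    obtain A B where "trace A = 0" "\<phi> A = a" "trace B = 0" "\<phi> B = b"
      using obtain_preimage ab by metis
    thus "a + b \<in> L" "a \<star> b \<in> L" using in_L[of "A + B"] in_L[of "mat_bracket A B"]
      by (simp_all add: \<phi>_add \<phi>_bracket trace_add)
  qed
qed

lemma isomorphic_quotient: "lie_isomorphic image_alg Q"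
  unfolding lie_isomorphic_def image_alg_simps
proof (intro exI[of _ fibre] conjI ballI allI)
  show "bij_betw fibre L (lcarrier Q)" using fibre_inj by (simp add: bij_betw_def Q_carrier)
qed (simp_all add: Q_ops Q_scale)

text \<open>An ideal of the quotient pulls back to an ideal of \<open>sl\<close>, which is either
  everything or consists of scalars and so lies in \<open>K\<close>. The quotient is not abelian
  because [E_ij, E_jk] = E_ik is not scalar.\<close>

lemma quotient_simple:
  assumes scalars: "range (\<lambda>c. mat_scale c (mat 1)) \<subseteq> K"
  shows "lie_simple Q"
proof -
  obtain j :: 'n where "j \<noteq> undefined" using exists_third[OF card] by blast
  moreover obtain k :: 'n where "k \<noteq> undefined" "k \<noteq> j" using exists_third[OF card] by blast
  ultimately obtain i j k :: 'n where ij: "i \<noteq> j" "k \<noteq> i" "k \<noteq> j" by blast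
  have tr0: "trace (unit_mat i j :: 'k^'n^'n) = 0" "trace (unit_mat j k :: 'k^'n^'n) = 0"
    "trace (unit_mat i k :: 'k^'n^'n) = 0"
    using ij by (simp_all add: trace_unit_mat)
  have "mat_bracket (unit_mat i j) (unit_mat j k) = (unit_mat i k :: 'k^'n^'n)"
    using ij by (simp add: vec_eq_iff mat_bracket_unit unit_mat_nth)
  moreover have "(unit_mat i k :: 'k^'n^'n) \<notin> K"
  proof
    assume "(unit_mat i k :: 'k^'n^'n) \<in> K"
    then obtain c where "unit_mat i k = mat_scale c (mat 1 :: 'k^'n^'n)" using K_scalar by blast
    hence "unit_mat i k $ i $ k = mat_scale c (mat 1 :: 'k^'n^'n) $ i $ k" by (rule arg_cong)
    thus False using ij by (simp add: unit_mat_nth mat_scale_nth mat_def)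
  qed
  ultimately have nz: "\<phi> (unit_mat i j) \<star> \<phi> (unit_mat j k) \<noteq> 0"
    using \<phi>_bracket[OF tr0(1,2)] tr0 by (simp add: K_def)
  have 0: "0 \<in> L" using in_L[of 0] trace_0 by simp
  have "\<exists>a\<in>lcarrier Q. \<exists>b\<in>lcarrier Q. lbracket Q a b \<noteq> lzero Q"
  proof (intro bexI)
    have "fibre (\<phi> (unit_mat i j) \<star> \<phi> (unit_mat j k)) \<noteq> fibre 0"
      using inj_on_eq_iff[OF fibre_inj L_closed(3)[OF in_L[OF tr0(1)] in_L[OF tr0(2)]] 0] nz by simp
    thus "lbracket Q (fibre (\<phi> (unit_mat i j))) (fibre (\<phi> (unit_mat j k))) \<noteq> lzero Q"
      using tr0 by (simp add: Q_ops Q_zero)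
  qed (use tr0 in \<open>simp_all add: Q_carrier\<close>)
  moreover have "J = {lzero Q} \<or> J = lcarrier Q" if J: "lie_ideal Q J" for J
  proof -
    define I where "I = {A. trace A = 0 \<and> fibre (\<phi> A) \<in> J}"
    have Jsub: "J \<subseteq> fibre ` L" and J0: "fibre 0 \<in> J"
      and Jadd: "\<And>a b. a \<in> J \<Longrightarrow> b \<in> J \<Longrightarrow> ladd Q a b \<in> J" and Jscale: "\<And>c a. a \<in> J \<Longrightarrow> lscale Q c a \<in> J"
      and Jbr: "\<And>a b. a \<in> fibre ` L \<Longrightarrow> b \<in> J \<Longrightarrow> lbracket Q a b \<in> J"
      using J unfolding lie_ideal_def Q_carrier Q_zero by auto
    have "lie_ideal sl I"
      unfolding lie_ideal_def sl_simps
    proof (intro conjI ballI allI)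
      show "0 \<in> I" using J0 trace_0 by (simp add: I_def)
      fix a b assume ab: "a \<in> I" "b \<in> I"
      show "a + b \<in> I" using ab Jadd[of "fibre (\<phi> a)" "fibre (\<phi> b)"]
        by (simp add: I_def Q_ops \<phi>_add trace_add)
    next
      fix c a assume a: "a \<in> I"
      show "mat_scale c a \<in> I" using a Jscale[of "fibre (\<phi> a)" c]
        by (auto simp: I_def Q_scale \<phi>_scale)
    next
      fix a b assume ab: "a \<in> {A :: 'k^'n^'n. trace A = 0}" "b \<in> I"
      show "mat_bracket a b \<in> I" using ab Jbr[of "fibre (\<phi> a)" "fibre (\<phi> b)"]
        by (simp add: I_def Q_ops \<phi>_bracket)
    qed (auto simp: I_def)
    hence "I = {A. trace A = 0} \<or> I \<subseteq> range (\<lambda>c. mat_scale c (mat 1))"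
      by (rule ideal_sl[OF _ card two])
    then consider "I = {A. trace A = 0}" | "I \<subseteq> K" using scalars by blast
    then show ?thesis
    proof cases
      case 1
      have "fibre ` L \<subseteq> J"
      proof
        fix y assume "y \<in> fibre ` L"
        then obtain A where A: "trace A = 0" "y = fibre (\<phi> A)" using \<phi>_image by blast
        hence "A \<in> I" using 1 by simp
        thus "y \<in> J" using A by (simp add: I_def)
      qed
      thus ?thesis using Jsub by (simp add: Q_carrier)
    next
      case 2
      have "y = fibre 0" if y: "y \<in> J" for y
      proof -
        obtain A where A: "trace A = 0" "y = fibre (\<phi> A)" using \<phi>_image Jsub y by blast
        hence "A \<in> I" using y by (simp add: I_def)
        hence "A \<in> K" using 2 by blast
        thus ?thesis using A by (simp add: K_def)
      qed
      hence "J = {fibre 0}" using J0 by blast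
      thus ?thesis by (simp add: Q_zero)
    qed
  qed
  ultimately show ?thesis unfolding lie_simple_def by blast
qed

text \<open>A nonzero kernel contains a nonzero scalar matrix. Its trace is zero, so the size
  vanishes in the field; by scaling, \<open>K\<close> is then the whole line of scalar
  matrices.\<close>

lemma sl_or_quotient:
  "lie_isomorphic image_alg (sl :: ('k, 'k^'n^'n) lie_alg) \<or>
    CHAR('k) dvd CARD('n) \<and> lie_ideal (sl :: ('k, 'k^'n^'n) lie_alg) K \<and>
    vector_space.dim mat_scale K = 1 \<and> lie_simple Q \<and> lie_isomorphic image_alg Q"
proof (cases "K = {0}")
  case True
  then show ?thesis using isomorphic_sl by simp
next
  case False
  interpret gl: lie_algebra mat_scale "mat_bracket :: 'k^'n^'n \<Rightarrow> _" by (rule lie_algebra_gl)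
  have "0 \<in> K" using trace_0 by (simp add: K_def)
  then obtain A where A: "A \<in> K" "A \<noteq> 0" using False by blast
  then obtain c where c: "A = mat_scale c (mat 1)" using K_scalar by blast
  have c0: "c \<noteq> 0" using A c gl.scale_zero_left by metis
  have tr1: "trace (mat 1 :: 'k^'n^'n) = of_nat CARD('n)" by (simp add: trace_def mat_def)
  have "c * trace (mat 1 :: 'k^'n^'n) = 0" using A c by (auto simp: K_def)
  hence dvd: "CHAR('k) dvd CARD('n)" using c0 tr1 by (simp add: of_nat_eq_0_iff_char_dvd)
  have "mat_scale d (mat 1) \<in> K" for d
  proof -
    have "mat_scale d (mat 1) = mat_scale (d / c) A"
      using c0 by (simp add: c gl.scale_scale)
    thus ?thesis using K_ideal A by (simp add: lie_ideal_def)
  qed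
  hence scalars: "range (\<lambda>c. mat_scale c (mat 1)) \<subseteq> K" by blast
  hence "K = gl.span {mat 1}" using K_scalar gl.span_singleton by blast
  moreover have "(mat 1 :: 'k^'n^'n) \<noteq> 0" by (simp add: vec_eq_iff mat_def)
  ultimately have "gl.dim K = 1"
    using gl.dim_span_eq_card_independent[of "{mat 1}"] by simp
  thus ?thesis using dvd K_ideal quotient_simple[OF scalars] isomorphic_quotient by blast
qed

end

text \<open>The map is linear on all matrices, whereas compatibility with brackets is asserted for
  trace zero only, which is where the correction terms at the base index \<open>b\<close>
  cancel.\<close>

lemma (in lie_algebra) sl_image_matrix_sum:
  fixes e :: "'n::finite \<Rightarrow> 'n \<Rightarrow> 'v"
  assumes st: "steinberg UNIV e" and nz: "lie_generated smul bracket (offdiag e UNIV) \<noteq> {0}"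
    and two: "(2 :: 'k) \<noteq> 0" and card: "CARD('n) \<ge> 3"
  shows "sl_image smul bracket (\<lambda>A :: 'k^'n^'n. matrix_sum UNIV (diag_ext b e) (\<lambda>i j. A $ i $ j))
    (lie_generated smul bracket (offdiag e UNIV))"
proof
  let ?\<phi> = "\<lambda>A :: 'k^'n^'n. matrix_sum UNIV (diag_ext b e) (\<lambda>i j. A $ i $ j)"
  fix A B :: "'k^'n^'n" and c
  show "?\<phi> (A + B) = ?\<phi> A + ?\<phi> B" by (simp add: matrix_sum_add)
  show "?\<phi> (mat_scale c A) = c \<odot> ?\<phi> A" by (simp add: mat_scale_nth matrix_sum_scale)
  show "?\<phi> (mat_bracket A B) = ?\<phi> A \<star> ?\<phi> B" if "trace A = 0" "trace B = 0"
  proof -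
    have "(\<lambda>i j. mat_bracket A B $ i $ j) =
        (\<lambda>i l. (\<Sum>j\<in>UNIV. A $ i $ j * B $ j $ l) - (\<Sum>j\<in>UNIV. B $ i $ j * A $ j $ l))"
      by (intro HOL.ext) (simp add: mat_bracket_def matrix_matrix_mult_def)
    thus ?thesis using that by (simp only: matrix_sum_bracket[OF st finite UNIV_I] trace_def)
  qed
  show "?\<phi> ` {A. trace A = 0} = lie_generated smul bracket (offdiag e UNIV)"
  proof -
    have "y \<in> ?\<phi> ` {A. trace A = 0}"
      if y: "y \<in> matrix_sum UNIV (diag_ext b e) ` {A. (\<Sum>i\<in>UNIV. A i i) = 0}" for y
    proof -
      obtain A where A: "y = matrix_sum UNIV (diag_ext b e) A" "(\<Sum>i\<in>UNIV. A i i) = 0"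
        using y by blast
      thus ?thesis by (intro image_eqI[where x = "\<chi> i j. A i j"]) (simp_all add: trace_def)
    qed
    moreover have "?\<phi> A \<in> matrix_sum UNIV (diag_ext b e) ` {A. (\<Sum>i\<in>UNIV. A i i) = 0}"
      if "trace A = 0" for A
      using that by (intro imageI) (simp add: trace_def)
    ultimately show ?thesis using lie_generated_offdiag[OF st, of b] by auto
  qed
qed (fact nz two card)+

text \<open>The induction along the graph uses natural numbers as indices, while matrices are
  indexed by a finite type; a bijection carries the system over.\<close>

lemma (in lie_algebra) steinberg_reindex:
  assumes st: "steinberg I e" and g: "bij_betw g J I"
  shows "steinberg J (\<lambda>i j. e (g i) (g j))" "offdiag (\<lambda>i j. e (g i) (g j)) J = offdiag e I"
proof -
  have inj: "g i = g j \<longleftrightarrow> i = j" if "i \<in> J" "j \<in> J" for i j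
    using g that by (auto simp: bij_betw_def inj_on_def)
  have mem: "g i \<in> I" if "i \<in> J" for i using g that by (auto simp: bij_betw_def)
  show "steinberg J (\<lambda>i j. e (g i) (g j))"
    unfolding steinberg_def
    by (intro conjI ballI impI)
      (simp_all add: inj mem steinberg_mult[OF st] steinberg_commute[OF st] steinberg_square[OF st])
  have I: "I = g ` J" using g by (simp add: bij_betw_def)
  show "offdiag (\<lambda>i j. e (g i) (g j)) J = offdiag e I"
    unfolding offdiag_def I using inj by blast
qed

theorem theorem7p3:
  fixes smul :: "'k::alg_closed_field \<Rightarrow> 'v::ab_group_add \<Rightarrow> 'v"
    and bracket :: "'v \<Rightarrow> 'v \<Rightarrow> 'v"
    and n :: nat
    and x :: "nat \<Rightarrow> 'v"
    and L :: "('k, 'v) lie_alg"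
    and f :: "'v \<Rightarrow> 'v \<Rightarrow> 'k"
  assumes "CHAR('k) \<noteq> 2"
    and "n = CARD('n::finite)"
    and "n \<ge> 3"
    and "lie_algebra smul bracket"
    and "L = lie_alg_on smul bracket (lie_generated smul bracket (x ` {1..n}))"
    and "realizes_graph smul bracket n (Gamma_A n) x"
    and "extremal_form L f"
    and "(f (x 1) (bracket (x 2) (x 3)))\<^sup>2 \<noteq> 2 * f (x 1) (x 2) * f (x 1) (x 3) * f (x 2) (x 3)"
    and "\<And>i. 1 \<le> i \<Longrightarrow> i \<le> n - 1 \<Longrightarrow> f (x i) (x (i + 1)) \<noteq> 0"
  shows "(CHAR('k) > 0 \<and> CHAR('k) dvd n \<longrightarrow>
            lie_isomorphic L (sl :: ('k, 'k^'n^'n) lie_alg) \<or>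
            (\<exists>I. lie_ideal (sl :: ('k, 'k^'n^'n) lie_alg) I \<and> vector_space.dim mat_scale I = 1 \<and>
                 lie_simple (lie_quotient (sl :: ('k, 'k^'n^'n) lie_alg) I) \<and>
                 lie_isomorphic L (lie_quotient (sl :: ('k, 'k^'n^'n) lie_alg) I))) \<and>
         (\<not> (CHAR('k) > 0 \<and> CHAR('k) dvd n) \<longrightarrow>
            lie_isomorphic L (sl :: ('k, 'k^'n^'n) lie_alg))"
proof -
  interpret lie_algebra smul bracket by fact
  define S where "S = lie_generated smul bracket (x ` {1..n})"
  have L: "lcarrier L = S" "lzero L = 0" "ladd L = (+)" "lscale L = smul" "lbracket L = bracket"
    using assms(5) by (simp_all add: S_def lie_alg_on_def)
  have x_extremal: "extremal L (x i)" if "i \<in> {1..n}" for i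
    using assms(6) that unfolding realizes_graph_def assms(5) by blast
  have two: "(2 :: 'k) \<noteq> 0"
  proof
    assume "(2 :: 'k) = 0"
    hence "of_nat 2 = (0 :: 'k)" by simp
    hence "CHAR('k) dvd 2" by (simp only: of_nat_eq_0_iff_char_dvd)
    hence "CHAR('k) = 1 \<or> CHAR('k) = 2" using two_is_prime_nat by (simp only: prime_nat_iff)
    thus False using assms(1) by simp
  qed
  have bil: "bilinear_form_on L f" and ef: "\<And>x y. extremal L x \<Longrightarrow> y \<in> S \<Longrightarrow> bracket x (bracket x y) = smul (f x y) x"
    using assms(7) by (auto simp: extremal_form_def L)
  have "extremal_algebra smul bracket S f"
  proof
    show "(2 :: 'k) \<noteq> 0" by (rule two)
    show "lie_subalgebra smul bracket S" unfolding S_def by (rule lie_generated_subalgebra)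
    show "f (a + b) z = f a z + f b z" "f z (a + b) = f z a + f z b" if "a \<in> S" "b \<in> S" "z \<in> S" for a b z
      using bil that by (auto simp: bilinear_form_on_def L)
    show "f (smul c a) z = c * f a z" "f z (smul c a) = c * f z a" if "a \<in> S" "z \<in> S" for c a z
      using bil that by (auto simp: bilinear_form_on_def L)
    show "bracket x (bracket x y) = smul (f x y) x"
      if "x \<in> S" "x \<noteq> 0" "\<forall>y\<in>S. \<exists>c. bracket x (bracket x y) = smul c x" "y \<in> S" for x y
      using ef[of x y] that by (simp add: extremal_def L)
    show "S \<subseteq> lie_generated smul bracket {x \<in> S. \<forall>y\<in>S. \<exists>c. bracket x (bracket x y) = smul c x}"
    proof -
      have "x ` {1..n} \<subseteq> {x \<in> S. \<forall>y\<in>S. \<exists>c. bracket x (bracket x y) = smul c x}"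
        using x_extremal by (auto simp: extremal_def L)
      hence "x ` {1..n} \<subseteq> lie_generated smul bracket {x \<in> S. \<forall>y\<in>S. \<exists>c. bracket x (bracket x y) = smul c x}"
        using lie_generated_superset by (rule subset_trans)
      thus ?thesis using lie_generated_least[OF lie_generated_subalgebra] unfolding S_def by blast
    qed
  qed
  then interpret extremal_algebra smul bracket S f .
  have "generic_realization smul bracket S f n x"
  proof
    show "ext (x i)" if "i \<in> {1..n}" for i
      using x_extremal[OF that] unfolding ext_def extremal_def L by blast
    show "bracket (x i) (x j) = 0" if "i \<in> {1..n}" "j \<in> {1..n}" "i + 1 < j" "4 \<le> j" for i j
    proof -
      have "{i, j} \<notin> Gamma_A n" using that by (auto simp: Gamma_A_def doubleton_eq_iff)
      moreover have "i \<noteq> j" using that by simp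
      ultimately show ?thesis using assms(6) that(1,2) unfolding realizes_graph_def by blast
    qed
  qed (use assms(8,9) in auto)
  then interpret generic_realization smul bracket S f n x .
  obtain e where e: "system n e" using exists_system[OF assms(3)] by blast
  obtain g :: "'n \<Rightarrow> nat" where g: "bij_betw g UNIV {..<n}"
    using ex_bij_betw_finite_nat[of "UNIV :: 'n set"] assms(2) by (auto simp: atLeast0LessThan)
  define e' where "e' = (\<lambda>i j. e (g i) (g j))"
  have st: "steinberg UNIV e'" and gen: "lie_generated smul bracket (offdiag e' UNIV) = S"
    using steinberg_reindex[OF _ g, of e] e[unfolded system_def] by (simp_all add: e'_def S_def)
  have "x 1 \<in> S" "x 1 \<noteq> 0" using x_extremal[of 1] assms(3) by (auto simp: extremal_def L)
  hence nz: "lie_generated smul bracket (offdiag e' UNIV) \<noteq> {0}" unfolding gen by blast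
  have card: "CARD('n) \<ge> 3" using assms(2,3) by simp
  interpret sl_image smul bracket
    "\<lambda>A :: 'k^'n^'n. matrix_sum UNIV (diag_ext undefined e') (\<lambda>i j. A $ i $ j)" S
    using sl_image_matrix_sum[OF st nz two card] unfolding gen .
  have "L = lie_alg_on smul bracket S" using assms(5) by (simp add: S_def)
  \<comment> \<open>Zero divides only zero, so a characteristic dividing n is positive and the case
    distinction matches that of \<open>sl_or_quotient\<close>.\<close>
  moreover have "CHAR('k) > 0" if "CHAR('k) dvd n" using that assms(3) by (intro Nat.gr0I) simp
  ultimately show ?thesis using sl_or_quotient assms(2) by metis
qed

end
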